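(* Let $H$ be a monoid, $N$ an abelian group and $\phi\colon H\times N\to N$ a valid action. The algebra $\widetilde{\mathcal{H}}^2_\phi(H,N)$, with operation $+$ and constant $0$, is an inverse monoid in which $(E,[-g])$ is the inverse of $(E,[g])$, where $-g$ denotes the pointwise inverse of the factor set $g$.
   Context: $H$ is a monoid and $N$ is an abelian group (written multiplicatively). Compatible pairs. An $H$-indexed equivalence relation $E$ on $N$ is a family $(\sim^h)_{h\in H}$ (also written $\sim^h_E$) of equivalence relations on $N$; $E\subseteq E'$ means pointwise inclusion. $E$ is admissible if for all $n,n',x\in N$, $h,y\in H$: (1) $n\sim^1 n'$ implies $n=n'$; (2) $n\sim^h n'$ implies $xn\sim^h xn'$; (3) $n\sim^h n'$ implies $n\sim^{hy}n'$. A map $\phi\colon H\times N\to N$ is compatible with an admissible $E$ (and $E$ with $\phi$) if (1) $n\sim^h n'$ implies $n\phi(h,x)\sim^h n'\phi(h,x)$ for all $x\in N$; (2) $n\sim^h n'$ implies $\phi(x,n)\sim^{xh}\phi(x,n')$ for all $x\in H$; (3) $\phi(h,nn')\sim^h\phi(h,n)\phi(h,n')$; (4) $\phi(hh',n)\sim^{hh'}\phi(h,\phi(h',n))$; (5) $\phi(h,1)\sim^h 1$; (6) $\phi(1,n)\sim^1 n$. Write $[\phi]=[\phi]_E$ for the class of $\phi$ under: $\phi\sim\phi'$ iff $\phi(h,n)\sim_E^h\phi'(h,n)$ for all $h,n$. A map $\phi\colon H\times N\to N$ is valid if it is compatible with some admissible $H$-indexed equivalence relation. For valid $\phi$, the (admissible)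 equivalence relations compatible with $\phi$, ordered by inclusion, form a complete lattice; $\vee$ denotes its join and $\bot$ its least element. Cohomology. A factor set for $(E,[\phi])$ is a map $g\colon H\times H\to N$ with $g(h,1)\sim^h 1\sim^h g(1,h)$ and $g(x,y)g(xy,z)\sim^{xyz}\phi(x,g(y,z))g(x,yz)$. Inner factor sets are those of the form $\delta t(h,h')=\phi(h,t(h'))\,t(hh')^{-1}t(h)$ for $t\colon H\to N$ with $t(1)=1$. Put $g\equiv g'$ iff there is an inner factor set $\delta t$ with $\delta t(h,h')\,g'(h,h')\sim^{hh'}g(h,h')$ for all $h,h'$. $\mathcal{H}^2(H,N,E,[\phi])$ is the abelian group of $\equiv$-classes $[g]=[g]_E$ of factor sets; the operation is induced by pointwise multiplication in $N$ and is written additively. If $E\subseteq E'$ are both compatible with $\phi$, then $\ell\colon\mathcal{H}^2(H,N,E,[\phi])\to\mathcal{H}^2(H,N,E',[\phi])$, $[g]_E\mapsto[g]_{E'}$, is a group homomorphism. The algebra. $\widetilde{\mathcal{H}}^2_\phi(H,N)$ is the set of pairs $(E,[g])$ where $E$ is an $H$-indexed equivalence relation compatible with $\phi$ and $[g]\in\mathcal{H}^2(H,N,E,[\phi])$, with operation $$(E_1,[g_1])+(E_2,[g_2])=(E_1\vee E_2,\ \ell_1([g_1])+\ell_2([g_2])),$$ where $\ell_i\colon\mathcal{H}^2(H,N,E_i,[\phi])\to\mathcal{H}^2(H,N,E_1\vee E_2,[\phi])$ are the maps $\ell$ above, and constant $0=(\bot,0)$. An inverse monoid is a monoid in which every element $a$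 has a unique element $b$ (its inverse) with $aba=a$ and $bab=b$. *)

theory Defs
  imports "HOL-Algebra.Algebra"
begin

section \<open>Inverse monoids\<close>

definition is_inverse_of :: "('a, 'b) monoid_scheme \<Rightarrow> 'a \<Rightarrow> 'a \<Rightarrow> bool" where
  "is_inverse_of M a b \<longleftrightarrow>
     b \<in> carrier M \<and> a \<otimes>\<^bsub>M\<^esub> b \<otimes>\<^bsub>M\<^esub> a = a \<and> b \<otimes>\<^bsub>M\<^esub> a \<otimes>\<^bsub>M\<^esub> b = b"

definition inverse_monoid :: "('a, 'b) monoid_scheme \<Rightarrow> bool" where
  "inverse_monoid M \<longleftrightarrow> monoid M \<and> (\<forall>a\<in>carrier M. \<exists>!b. is_inverse_of M a b)"


section \<open>Indexed equivalence relations and compatible maps\<close>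

text \<open>
  A family of relations is a function \<open>E\<close> with \<open>(n, n') \<in> E h\<close> for \<open>n \<sim>\<^sup>h n'\<close>. It is required to be
  \<^const>\<open>extensional\<close>, so that two families are equal as soon as they agree on \<open>carrier H\<close>;
  the same convention is used for factor sets below.
\<close>

definition indexed_equiv ::
  "('h, 'p) monoid_scheme \<Rightarrow> ('n, 'q) monoid_scheme \<Rightarrow> ('h \<Rightarrow> 'n rel) \<Rightarrow> bool" where
  "indexed_equiv H N E \<longleftrightarrow>
     E \<in> extensional (carrier H) \<and> (\<forall>h\<in>carrier H. equiv (carrier N) (E h))"

definition admissible ::
  "('h, 'p) monoid_scheme \<Rightarrow> ('n, 'q) monoid_scheme \<Rightarrow> ('h \<Rightarrow> 'n rel) \<Rightarrow> bool" where
  "admissible H N E \<longleftrightarrow> indexed_equiv H N E \<and>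
     (\<forall>n\<in>carrier N. \<forall>n'\<in>carrier N. (n, n') \<in> E \<one>\<^bsub>H\<^esub> \<longrightarrow> n = n') \<and>
     (\<forall>n\<in>carrier N. \<forall>n'\<in>carrier N. \<forall>x\<in>carrier N. \<forall>h\<in>carrier H.
        (n, n') \<in> E h \<longrightarrow> (x \<otimes>\<^bsub>N\<^esub> n, x \<otimes>\<^bsub>N\<^esub> n') \<in> E h) \<and>
     (\<forall>n\<in>carrier N. \<forall>n'\<in>carrier N. \<forall>h\<in>carrier H. \<forall>y\<in>carrier H.
        (n, n') \<in> E h \<longrightarrow> (n, n') \<in> E (h \<otimes>\<^bsub>H\<^esub> y))"

definition compatible ::
  "('h, 'p) monoid_scheme \<Rightarrow> ('n, 'q) monoid_scheme \<Rightarrow> ('h \<times> 'n \<Rightarrow> 'n) \<Rightarrow> ('h \<Rightarrow> 'n rel) \<Rightarrow> bool"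
where
  "compatible H N \<phi> E \<longleftrightarrow>
     \<phi> \<in> carrier H \<times> carrier N \<rightarrow> carrier N \<and>
     admissible H N E \<and>
     (\<forall>h\<in>carrier H. \<forall>n\<in>carrier N. \<forall>n'\<in>carrier N. \<forall>x\<in>carrier N.
        (n, n') \<in> E h \<longrightarrow> (n \<otimes>\<^bsub>N\<^esub> \<phi> (h, x), n' \<otimes>\<^bsub>N\<^esub> \<phi> (h, x)) \<in> E h) \<and>
     (\<forall>h\<in>carrier H. \<forall>n\<in>carrier N. \<forall>n'\<in>carrier N. \<forall>x\<in>carrier H.
        (n, n') \<in> E h \<longrightarrow> (\<phi> (x, n), \<phi> (x, n')) \<in> E (x \<otimes>\<^bsub>H\<^esub> h)) \<and>
     (\<forall>h\<in>carrier H. \<forall>n\<in>carrier N. \<forall>n'\<in>carrier N.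
        (\<phi> (h, n \<otimes>\<^bsub>N\<^esub> n'), \<phi> (h, n) \<otimes>\<^bsub>N\<^esub> \<phi> (h, n')) \<in> E h) \<and>
     (\<forall>h\<in>carrier H. \<forall>h'\<in>carrier H. \<forall>n\<in>carrier N.
        (\<phi> (h \<otimes>\<^bsub>H\<^esub> h', n), \<phi> (h, \<phi> (h', n))) \<in> E (h \<otimes>\<^bsub>H\<^esub> h')) \<and>
     (\<forall>h\<in>carrier H. (\<phi> (h, \<one>\<^bsub>N\<^esub>), \<one>\<^bsub>N\<^esub>) \<in> E h) \<and>
     (\<forall>n\<in>carrier N. (\<phi> (\<one>\<^bsub>H\<^esub>, n), n) \<in> E \<one>\<^bsub>H\<^esub>)"

definition valid_action ::
  "('h, 'p) monoid_scheme \<Rightarrow> ('n, 'q) monoid_scheme \<Rightarrow> ('h \<times> 'n \<Rightarrow> 'n) \<Rightarrow> bool" where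
  "valid_action H N \<phi> \<longleftrightarrow> (\<exists>E. compatible H N \<phi> E)"

definition compatible_order ::
  "('h, 'p) monoid_scheme \<Rightarrow> ('n, 'q) monoid_scheme \<Rightarrow> ('h \<times> 'n \<Rightarrow> 'n) \<Rightarrow> ('h \<Rightarrow> 'n rel) gorder"
where
  "compatible_order H N \<phi> =
     \<lparr>carrier = {E. compatible H N \<phi> E}, eq = (=), le = (\<lambda>E E'. \<forall>h\<in>carrier H. E h \<subseteq> E' h)\<rparr>"


section \<open>Cohomology\<close>

text \<open>
  The action enters the definitions of this section through a representative \<open>\<phi>\<close> of the class
  \<open>[\<phi>]\<^sub>E\<close>; the lemma \<open>H2_cong_action\<close> below shows that the choice of representative is
  irrelevant.
\<close>

definition same_action ::
  "('h, 'p) monoid_scheme \<Rightarrow> ('n, 'q) monoid_scheme \<Rightarrow> ('h \<Rightarrow> 'n rel) \<Rightarrow>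
   ('h \<times> 'n \<Rightarrow> 'n) \<Rightarrow> ('h \<times> 'n \<Rightarrow> 'n) \<Rightarrow> bool" where
  "same_action H N E \<phi> \<phi>' \<longleftrightarrow> (\<forall>h\<in>carrier H. \<forall>n\<in>carrier N. (\<phi> (h, n), \<phi>' (h, n)) \<in> E h)"

definition factor_sets ::
  "('h, 'p) monoid_scheme \<Rightarrow> ('n, 'q) monoid_scheme \<Rightarrow> ('h \<Rightarrow> 'n rel) \<Rightarrow> ('h \<times> 'n \<Rightarrow> 'n) \<Rightarrow>
   ('h \<times> 'h \<Rightarrow> 'n) set" where
  "factor_sets H N E \<phi> =
     {g \<in> carrier H \<times> carrier H \<rightarrow>\<^sub>E carrier N.
        (\<forall>h\<in>carrier H. (g (h, \<one>\<^bsub>H\<^esub>), \<one>\<^bsub>N\<^esub>) \<in> E h \<and> (\<one>\<^bsub>N\<^esub>, g (\<one>\<^bsub>H\<^esub>, h)) \<in> E h) \<and>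
        (\<forall>x\<in>carrier H. \<forall>y\<in>carrier H. \<forall>z\<in>carrier H.
           (g (x, y) \<otimes>\<^bsub>N\<^esub> g (x \<otimes>\<^bsub>H\<^esub> y, z), \<phi> (x, g (y, z)) \<otimes>\<^bsub>N\<^esub> g (x, y \<otimes>\<^bsub>H\<^esub> z))
             \<in> E (x \<otimes>\<^bsub>H\<^esub> y \<otimes>\<^bsub>H\<^esub> z))}"

definition coboundary ::
  "('h, 'p) monoid_scheme \<Rightarrow> ('n, 'q) monoid_scheme \<Rightarrow> ('h \<times> 'n \<Rightarrow> 'n) \<Rightarrow> ('h \<Rightarrow> 'n) \<Rightarrow>
   'h \<times> 'h \<Rightarrow> 'n" where
  "coboundary H N \<phi> t =
     (\<lambda>(h, h')\<in>carrier H \<times> carrier H.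
        \<phi> (h, t h') \<otimes>\<^bsub>N\<^esub> inv\<^bsub>N\<^esub> t (h \<otimes>\<^bsub>H\<^esub> h') \<otimes>\<^bsub>N\<^esub> t h)"

definition inner_factor_sets ::
  "('h, 'p) monoid_scheme \<Rightarrow> ('n, 'q) monoid_scheme \<Rightarrow> ('h \<times> 'n \<Rightarrow> 'n) \<Rightarrow>
   ('h \<times> 'h \<Rightarrow> 'n) set" where
  "inner_factor_sets H N \<phi> =
     {coboundary H N \<phi> t | t. t \<in> carrier H \<rightarrow> carrier N \<and> t \<one>\<^bsub>H\<^esub> = \<one>\<^bsub>N\<^esub>}"

definition cohomologous ::
  "('h, 'p) monoid_scheme \<Rightarrow> ('n, 'q) monoid_scheme \<Rightarrow> ('h \<Rightarrow> 'n rel) \<Rightarrow> ('h \<times> 'n \<Rightarrow> 'n) \<Rightarrow>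
   ('h \<times> 'h \<Rightarrow> 'n) rel" where
  "cohomologous H N E \<phi> =
     {(g, g'). g \<in> factor_sets H N E \<phi> \<and> g' \<in> factor_sets H N E \<phi> \<and>
        (\<exists>d\<in>inner_factor_sets H N \<phi>. \<forall>h\<in>carrier H. \<forall>h'\<in>carrier H.
           (d (h, h') \<otimes>\<^bsub>N\<^esub> g' (h, h'), g (h, h')) \<in> E (h \<otimes>\<^bsub>H\<^esub> h'))}"

definition factor_class ::
  "('h, 'p) monoid_scheme \<Rightarrow> ('n, 'q) monoid_scheme \<Rightarrow> ('h \<Rightarrow> 'n rel) \<Rightarrow> ('h \<times> 'n \<Rightarrow> 'n) \<Rightarrow>
   ('h \<times> 'h \<Rightarrow> 'n) \<Rightarrow> ('h \<times> 'h \<Rightarrow> 'n) set" where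
  "factor_class H N E \<phi> g = cohomologous H N E \<phi> `` {g}"

definition factor_mult ::
  "('h, 'p) monoid_scheme \<Rightarrow> ('n, 'q) monoid_scheme \<Rightarrow>
   ('h \<times> 'h \<Rightarrow> 'n) \<Rightarrow> ('h \<times> 'h \<Rightarrow> 'n) \<Rightarrow> 'h \<times> 'h \<Rightarrow> 'n" where
  "factor_mult H N g g' = (\<lambda>p\<in>carrier H \<times> carrier H. g p \<otimes>\<^bsub>N\<^esub> g' p)"

definition factor_one ::
  "('h, 'p) monoid_scheme \<Rightarrow> ('n, 'q) monoid_scheme \<Rightarrow> 'h \<times> 'h \<Rightarrow> 'n" where
  "factor_one H N = (\<lambda>p\<in>carrier H \<times> carrier H. \<one>\<^bsub>N\<^esub>)"

definition factor_inv ::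
  "('h, 'p) monoid_scheme \<Rightarrow> ('n, 'q) monoid_scheme \<Rightarrow> ('h \<times> 'h \<Rightarrow> 'n) \<Rightarrow> 'h \<times> 'h \<Rightarrow> 'n" where
  "factor_inv H N g = (\<lambda>p\<in>carrier H \<times> carrier H. inv\<^bsub>N\<^esub> g p)"

text \<open>
  Operations on classes are defined as unions over all representatives; since they are
  independent of the representatives, each union is the class of the result for any one choice.
  The second cohomology group and the algebra built from these groups, written additively in the
  literature, are monoid records here, hence written with \<open>\<otimes>\<close> and \<open>\<one>\<close>.
\<close>

definition H2 ::
  "('h, 'p) monoid_scheme \<Rightarrow> ('n, 'q) monoid_scheme \<Rightarrow> ('h \<Rightarrow> 'n rel) \<Rightarrow> ('h \<times> 'n \<Rightarrow> 'n) \<Rightarrow>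
   ('h \<times> 'h \<Rightarrow> 'n) set monoid" where
  "H2 H N E \<phi> =
     \<lparr>carrier = factor_sets H N E \<phi> // cohomologous H N E \<phi>,
      monoid.mult = (\<lambda>A B. \<Union>g\<in>A. \<Union>g'\<in>B. factor_class H N E \<phi> (factor_mult H N g g')),
      one = factor_class H N E \<phi> (factor_one H N)\<rparr>"

definition H2_map ::
  "('h, 'p) monoid_scheme \<Rightarrow> ('n, 'q) monoid_scheme \<Rightarrow> ('h \<times> 'n \<Rightarrow> 'n) \<Rightarrow> ('h \<Rightarrow> 'n rel) \<Rightarrow>
   ('h \<times> 'h \<Rightarrow> 'n) set \<Rightarrow> ('h \<times> 'h \<Rightarrow> 'n) set" where
  "H2_map H N \<phi> E' A = (\<Union>g\<in>A. factor_class H N E' \<phi> g)"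

definition H2_tilde ::
  "('h, 'p) monoid_scheme \<Rightarrow> ('n, 'q) monoid_scheme \<Rightarrow> ('h \<times> 'n \<Rightarrow> 'n) \<Rightarrow>
   (('h \<Rightarrow> 'n rel) \<times> ('h \<times> 'h \<Rightarrow> 'n) set) monoid" where
  "H2_tilde H N \<phi> =
     \<lparr>carrier = (SIGMA E : {E. compatible H N \<phi> E}. carrier (H2 H N E \<phi>)),
      monoid.mult = (\<lambda>(E\<^sub>1, A\<^sub>1) (E\<^sub>2, A\<^sub>2).
        let E = E\<^sub>1 \<squnion>\<^bsub>compatible_order H N \<phi>\<^esub> E\<^sub>2
        in (E, H2_map H N \<phi> E A\<^sub>1 \<otimes>\<^bsub>H2 H N E \<phi>\<^esub> H2_map H N \<phi> E A\<^sub>2)),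
      one = (\<bottom>\<^bsub>compatible_order H N \<phi>\<^esub>, \<one>\<^bsub>H2 H N (\<bottom>\<^bsub>compatible_order H N \<phi>\<^esub>) \<phi>\<^esub>)\<rparr>"


subsection \<open>Independence of the representative of the action\<close>

context
  fixes H :: "('h, 'p) monoid_scheme" and N :: "('n, 'q) monoid_scheme"
    and E \<phi> \<phi>'
  assumes H: "monoid H" and N: "comm_group N"
    and c: "compatible H N \<phi> E" and c': "compatible H N \<phi>' E"
    and s: "same_action H N E \<phi> \<phi>'"
begin

interpretation H: monoid H by (rule H)
interpretation N: comm_group N by (rule N)

lemma same_action_sym: "same_action H N E \<phi>' \<phi>"
proof -
  have "sym (E h)" if "h \<in> carrier H" for h
    using c that by (auto simp: compatible_def admissible_def indexed_equiv_def equiv_def)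
  then show ?thesis
    using s unfolding same_action_def by (blast dest: symD)
qed

lemma mult_rel:
  assumes "h \<in> carrier H" "y \<in> carrier H" "n \<in> carrier N" "x \<in> carrier N"
  shows "(\<phi> (h, n) \<otimes>\<^bsub>N\<^esub> x, \<phi>' (h, n) \<otimes>\<^bsub>N\<^esub> x) \<in> E (h \<otimes>\<^bsub>H\<^esub> y)"
proof -
  have cl: "\<phi> (h, n) \<in> carrier N" "\<phi>' (h, n) \<in> carrier N"
    using c c' assms by (auto simp: compatible_def)
  have "(\<phi> (h, n), \<phi>' (h, n)) \<in> E h"
    using s assms by (simp add: same_action_def)
  then have "(x \<otimes>\<^bsub>N\<^esub> \<phi> (h, n), x \<otimes>\<^bsub>N\<^esub> \<phi>' (h, n)) \<in> E (h \<otimes>\<^bsub>H\<^esub> y)"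
    using c assms cl unfolding compatible_def admissible_def by simp
  then show ?thesis
    using assms cl by (simp add: N.m_comm)
qed

lemma rel_equiv: "h \<in> carrier H \<Longrightarrow> equiv (carrier N) (E h)"
  using c by (simp add: compatible_def admissible_def indexed_equiv_def)

lemma rel_trans:
  "h \<in> carrier H \<Longrightarrow> (a, b) \<in> E h \<Longrightarrow> (b, d) \<in> E h \<Longrightarrow> (a, d) \<in> E h"
  using rel_equiv unfolding equiv_def by (blast dest: transD)

lemma rel_sym: "h \<in> carrier H \<Longrightarrow> (a, b) \<in> E h \<Longrightarrow> (b, a) \<in> E h"
  using rel_equiv unfolding equiv_def by (blast dest: symD)

lemma factor_sets_sub: "factor_sets H N E \<phi> \<subseteq> factor_sets H N E \<phi>'"
proof
  fix g assume g: "g \<in> factor_sets H N E \<phi>"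
  then have cl: "g (x, y) \<in> carrier N" if "x \<in> carrier H" "y \<in> carrier H" for x y
    using that by (auto simp: factor_sets_def PiE_def Pi_def)
  have "(g (x, y) \<otimes>\<^bsub>N\<^esub> g (x \<otimes>\<^bsub>H\<^esub> y, z), \<phi>' (x, g (y, z)) \<otimes>\<^bsub>N\<^esub> g (x, y \<otimes>\<^bsub>H\<^esub> z))
          \<in> E (x \<otimes>\<^bsub>H\<^esub> y \<otimes>\<^bsub>H\<^esub> z)"
    if "x \<in> carrier H" "y \<in> carrier H" "z \<in> carrier H" for x y z
  proof (rule rel_trans)
    show "(g (x, y) \<otimes>\<^bsub>N\<^esub> g (x \<otimes>\<^bsub>H\<^esub> y, z), \<phi> (x, g (y, z)) \<otimes>\<^bsub>N\<^esub> g (x, y \<otimes>\<^bsub>H\<^esub> z))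
            \<in> E (x \<otimes>\<^bsub>H\<^esub> y \<otimes>\<^bsub>H\<^esub> z)"
      using g that by (simp add: factor_sets_def)
    show "(\<phi> (x, g (y, z)) \<otimes>\<^bsub>N\<^esub> g (x, y \<otimes>\<^bsub>H\<^esub> z), \<phi>' (x, g (y, z)) \<otimes>\<^bsub>N\<^esub> g (x, y \<otimes>\<^bsub>H\<^esub> z))
            \<in> E (x \<otimes>\<^bsub>H\<^esub> y \<otimes>\<^bsub>H\<^esub> z)"
      using mult_rel[of x "y \<otimes>\<^bsub>H\<^esub> z"] that cl by (simp add: H.m_assoc)
  qed (use that in simp)
  with g show "g \<in> factor_sets H N E \<phi>'"
    by (simp add: factor_sets_def)
qed

lemma cohomologous_sub: "cohomologous H N E \<phi> \<subseteq> cohomologous H N E \<phi>'"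
proof
  fix p assume p: "p \<in> cohomologous H N E \<phi>"
  obtain g g' where pgg: "p = (g, g')" by (cases p)
  with p obtain t where fs: "g \<in> factor_sets H N E \<phi>" "g' \<in> factor_sets H N E \<phi>"
    and t: "t \<in> carrier H \<rightarrow> carrier N" "t \<one>\<^bsub>H\<^esub> = \<one>\<^bsub>N\<^esub>"
    and rel: "\<And>h h'. h \<in> carrier H \<Longrightarrow> h' \<in> carrier H \<Longrightarrow>
      (coboundary H N \<phi> t (h, h') \<otimes>\<^bsub>N\<^esub> g' (h, h'), g (h, h')) \<in> E (h \<otimes>\<^bsub>H\<^esub> h')"
    unfolding cohomologous_def inner_factor_sets_def by blast
  have "(coboundary H N \<phi>' t (h, h') \<otimes>\<^bsub>N\<^esub> g' (h, h'), g (h, h')) \<in> E (h \<otimes>\<^bsub>H\<^esub> h')"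
    if h: "h \<in> carrier H" "h' \<in> carrier H" for h h'
  proof -
    have tc: "t h \<in> carrier N" "t h' \<in> carrier N" "t (h \<otimes>\<^bsub>H\<^esub> h') \<in> carrier N"
      using t h by auto
    have g': "g' (h, h') \<in> carrier N"
      using fs h by (auto simp: factor_sets_def PiE_def Pi_def)
    have pc: "\<phi> (h, t h') \<in> carrier N" "\<phi>' (h, t h') \<in> carrier N"
      using c c' h tc by (auto simp: compatible_def)
    have "(coboundary H N \<phi> t (h, h') \<otimes>\<^bsub>N\<^esub> g' (h, h'), coboundary H N \<phi>' t (h, h') \<otimes>\<^bsub>N\<^esub> g' (h, h'))
            \<in> E (h \<otimes>\<^bsub>H\<^esub> h')"
      using mult_rel[OF h tc(2), of "inv\<^bsub>N\<^esub> t (h \<otimes>\<^bsub>H\<^esub> h') \<otimes>\<^bsub>N\<^esub> t h \<otimes>\<^bsub>N\<^esub> g' (h, h')"] h tc g' pc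
      by (simp add: coboundary_def N.m_assoc)
    from rel_trans[OF _ rel_sym[OF _ this] rel[OF h]] show ?thesis
      using h by simp
  qed
  then show "p \<in> cohomologous H N E \<phi>'"
    using pgg fs t factor_sets_sub unfolding cohomologous_def inner_factor_sets_def by blast
qed

end

lemma H2_cong_action:
  assumes "monoid H" "comm_group N" "compatible H N \<phi> E" "compatible H N \<phi>' E"
    and "same_action H N E \<phi> \<phi>'"
  shows "H2 H N E \<phi> = H2 H N E \<phi>'"
proof -
  have "same_action H N E \<phi>' \<phi>"
    by (rule same_action_sym[OF assms])
  then have "factor_sets H N E \<phi> = factor_sets H N E \<phi>'"
    and "cohomologous H N E \<phi> = cohomologous H N E \<phi>'"
    using factor_sets_sub[of H N] cohomologous_sub[of H N] assms by (metis subset_antisym)+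
  then show ?thesis
    by (simp add: H2_def factor_class_def)
qed

end

theory Submission
  imports Defs
begin

text \<open>
  The algebra is a family of abelian groups, one for each compatible \<open>E\<close>, glued together along a
  join semilattice with least element (a strong semilattice of abelian groups). Every computation
  takes place on representatives: once the transition maps \<open>\<ell>\<close> are known to be given by
  \<open>[g]\<^sub>E \<mapsto> [g]\<^sub>E\<^sub>'\<close>, the operation reads
  \<open>(E\<^sub>1, [g\<^sub>1]) + (E\<^sub>2, [g\<^sub>2]) = (E\<^sub>1 \<or> E\<^sub>2, [g\<^sub>1 g\<^sub>2])\<close> (lemma \<open>tilde_mult\<close>). Associativity,
  commutativity and the unit law then split into the laws of the semilattice in the first component
  and those of pointwise multiplication in \<open>N\<close> in the second; and \<open>(E, [g]) + (E, [g\<^sup>-\<^sup>1])\<close> is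
  \<open>(E, [1])\<close>, which acts as a unit on all pairs over \<open>E\<close> because \<open>E \<or> E = E\<close>. Thus the algebra is
  a commutative monoid in which each element has an inverse \<open>b\<close> with \<open>a b a = a\<close> and
  \<open>b a b = b\<close>, and commutativity makes such inverses unique (lemma \<open>is_inverse_of_unique\<close>).

  Two things have to be supplied. The first is the semilattice. The least compatible family is the
  pointwise intersection of all of them. The join of two cannot be obtained in this way without
  first finding an upper bound that is still trivial at \<open>1\<close>; here it is the pointwise relational
  composition \<open>E\<^sub>1 h O E\<^sub>2 h\<close>, which is an equivalence relation because the two are congruences on
  a group and therefore commute (lemma \<open>compatible_relcomp\<close>).

  The second is that multiplication of factor sets respects \<open>\<equiv>\<close>. The map \<open>\<phi> (x, _)\<close> is a
  homomorphism only up to \<open>\<sim>\<^sup>x\<close>, but admissibility pushes this relation forward to \<open>\<sim>\<^sup>x\<^sup>y\<close> for each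
  \<open>y\<close>. The cocycle identity at \<open>(x, y, z)\<close> is required modulo \<open>\<sim>\<^sup>x\<^sup>y\<^sup>z\<close>, and the relation \<open>\<equiv>\<close> at
  \<open>(h, h')\<close> modulo \<open>\<sim>\<^sup>h\<^sup>h\<^sup>'\<close>, so at each place where they occur \<open>\<phi>\<close> behaves like an honest
  homomorphism and the classical arguments for group cohomology carry over.
\<close>

section \<open>Congruence properties of a compatible family\<close>

locale compatible_family = H: monoid H + N: comm_group N
  for H :: "('h, 'p) monoid_scheme" and N :: "('n, 'q) monoid_scheme" +
  fixes \<phi> :: "'h \<times> 'n \<Rightarrow> 'n" and E :: "'h \<Rightarrow> 'n rel"
  assumes compatible: "compatible H N \<phi> E"
begin

lemma rel_equiv: "h \<in> carrier H \<Longrightarrow> equiv (carrier N) (E h)"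
  using compatible by (simp add: compatible_def admissible_def indexed_equiv_def)

lemma rel_closed:
  assumes "h \<in> carrier H" "(a, b) \<in> E h"
  shows "a \<in> carrier N" "b \<in> carrier N"
  using equiv_type[OF rel_equiv[OF assms(1)]] assms(2) by auto

lemma rel_refl: "h \<in> carrier H \<Longrightarrow> a \<in> carrier N \<Longrightarrow> (a, a) \<in> E h"
  using rel_equiv by (blast dest: equivE refl_onD)

lemma rel_sym: "h \<in> carrier H \<Longrightarrow> (a, b) \<in> E h \<Longrightarrow> (b, a) \<in> E h"
  using rel_equiv by (blast dest: equivE symD)

lemma rel_trans: "h \<in> carrier H \<Longrightarrow> (a, b) \<in> E h \<Longrightarrow> (b, c) \<in> E h \<Longrightarrow> (a, c) \<in> E h"
  using rel_equiv by (blast dest: equivE transD)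

lemma rel_one_imp_eq: "(a, b) \<in> E \<one>\<^bsub>H\<^esub> \<Longrightarrow> a = b"
  using compatible rel_closed[of "\<one>\<^bsub>H\<^esub>"] by (auto simp: compatible_def admissible_def)

lemma rel_up:
  "h \<in> carrier H \<Longrightarrow> y \<in> carrier H \<Longrightarrow> (a, b) \<in> E h \<Longrightarrow> (a, b) \<in> E (h \<otimes>\<^bsub>H\<^esub> y)"
  using compatible rel_closed[of h a b] by (auto simp: compatible_def admissible_def)

lemma rel_lmult:
  "h \<in> carrier H \<Longrightarrow> x \<in> carrier N \<Longrightarrow> (a, b) \<in> E h \<Longrightarrow> (x \<otimes>\<^bsub>N\<^esub> a, x \<otimes>\<^bsub>N\<^esub> b) \<in> E h"
  using compatible rel_closed[of h a b] by (auto simp: compatible_def admissible_def)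

lemma rel_mult:
  assumes h: "h \<in> carrier H" and ab: "(a, b) \<in> E h" and cd: "(c, d) \<in> E h"
  shows "(a \<otimes>\<^bsub>N\<^esub> c, b \<otimes>\<^bsub>N\<^esub> d) \<in> E h"
proof (rule rel_trans[OF h])
  note cl = rel_closed[OF h ab] rel_closed[OF h cd]
  show "(a \<otimes>\<^bsub>N\<^esub> c, a \<otimes>\<^bsub>N\<^esub> d) \<in> E h"
    using rel_lmult[OF h _ cd] cl by simp
  show "(a \<otimes>\<^bsub>N\<^esub> d, b \<otimes>\<^bsub>N\<^esub> d) \<in> E h"
    using rel_lmult[OF h _ ab, of d] cl by (simp add: N.m_comm)
qed

lemma rel_inv:
  assumes h: "h \<in> carrier H" and ab: "(a, b) \<in> E h"
  shows "(inv\<^bsub>N\<^esub> a, inv\<^bsub>N\<^esub> b) \<in> E h"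
proof -
  note cl = rel_closed[OF h ab]
  have "(inv\<^bsub>N\<^esub> a \<otimes>\<^bsub>N\<^esub> inv\<^bsub>N\<^esub> b \<otimes>\<^bsub>N\<^esub> b, inv\<^bsub>N\<^esub> a \<otimes>\<^bsub>N\<^esub> inv\<^bsub>N\<^esub> b \<otimes>\<^bsub>N\<^esub> a) \<in> E h"
    using rel_lmult[OF h _ rel_sym[OF h ab]] cl by simp
  moreover have "inv\<^bsub>N\<^esub> a \<otimes>\<^bsub>N\<^esub> inv\<^bsub>N\<^esub> b \<otimes>\<^bsub>N\<^esub> b = inv\<^bsub>N\<^esub> a"
    using cl by (simp add: N.m_assoc)
  moreover have "inv\<^bsub>N\<^esub> a \<otimes>\<^bsub>N\<^esub> inv\<^bsub>N\<^esub> b \<otimes>\<^bsub>N\<^esub> a = inv\<^bsub>N\<^esub> b"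
    using cl by (simp add: N.m_comm[of _ a] N.m_assoc[symmetric])
  ultimately show ?thesis
    by simp
qed

lemma act_closed: "h \<in> carrier H \<Longrightarrow> n \<in> carrier N \<Longrightarrow> \<phi> (h, n) \<in> carrier N"
  using compatible by (auto simp: compatible_def)

lemma act_rel:
  "x \<in> carrier H \<Longrightarrow> h \<in> carrier H \<Longrightarrow> (a, b) \<in> E h \<Longrightarrow> (\<phi> (x, a), \<phi> (x, b)) \<in> E (x \<otimes>\<^bsub>H\<^esub> h)"
  using compatible rel_closed[of h a b] by (auto simp: compatible_def)

lemma act_mult:
  "h \<in> carrier H \<Longrightarrow> a \<in> carrier N \<Longrightarrow> b \<in> carrier N \<Longrightarrow>
   (\<phi> (h, a \<otimes>\<^bsub>N\<^esub> b), \<phi> (h, a) \<otimes>\<^bsub>N\<^esub> \<phi> (h, b)) \<in> E h"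
  using compatible by (auto simp: compatible_def)

lemma act_assoc:
  "h \<in> carrier H \<Longrightarrow> h' \<in> carrier H \<Longrightarrow> n \<in> carrier N \<Longrightarrow>
   (\<phi> (h \<otimes>\<^bsub>H\<^esub> h', n), \<phi> (h, \<phi> (h', n))) \<in> E (h \<otimes>\<^bsub>H\<^esub> h')"
  using compatible by (auto simp: compatible_def)

lemma act_one: "h \<in> carrier H \<Longrightarrow> (\<phi> (h, \<one>\<^bsub>N\<^esub>), \<one>\<^bsub>N\<^esub>) \<in> E h"
  using compatible by (auto simp: compatible_def)

lemma act_by_one: "n \<in> carrier N \<Longrightarrow> (\<phi> (\<one>\<^bsub>H\<^esub>, n), n) \<in> E \<one>\<^bsub>H\<^esub>"
  using compatible by (auto simp: compatible_def)

lemma act_inv: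
  assumes h: "h \<in> carrier H" and n: "n \<in> carrier N"
  shows "(\<phi> (h, inv\<^bsub>N\<^esub> n), inv\<^bsub>N\<^esub> \<phi> (h, n)) \<in> E h"
proof -
  have cl: "\<phi> (h, n) \<in> carrier N" "\<phi> (h, inv\<^bsub>N\<^esub> n) \<in> carrier N"
    using act_closed h n by auto
  have "(\<phi> (h, n) \<otimes>\<^bsub>N\<^esub> \<phi> (h, inv\<^bsub>N\<^esub> n), \<one>\<^bsub>N\<^esub>) \<in> E h"
    using rel_trans[OF h rel_sym[OF h act_mult[OF h n]] ] act_one[OF h] n by force
  from rel_lmult[OF h _ this, of "inv\<^bsub>N\<^esub> \<phi> (h, n)"] show ?thesis
    using cl by (simp add: N.m_assoc[symmetric])
qed

end


section \<open>The semilattice of compatible families\<close>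

text \<open>
  A single introduction rule for intersections and compositions, with the conditions freed from the
  restriction to \<open>carrier H\<close>. Compatibility with right multiplication by \<open>\<phi> (h, x)\<close> comes from
  left invariance, \<open>N\<close> being commutative.
\<close>

lemma compatible_restrictI:
  assumes "monoid H" and "comm_group N"
    and act: "\<And>h n. h \<in> carrier H \<Longrightarrow> n \<in> carrier N \<Longrightarrow> \<phi> (h, n) \<in> carrier N"
    and equiv: "\<And>h. h \<in> carrier H \<Longrightarrow> equiv (carrier N) (F h)"
    and one: "\<And>n n'. (n, n') \<in> F \<one>\<^bsub>H\<^esub> \<Longrightarrow> n = n'"
    and lmult: "\<And>h x n n'. h \<in> carrier H \<Longrightarrow> x \<in> carrier N \<Longrightarrow> (n, n') \<in> F h \<Longrightarrow>
      (x \<otimes>\<^bsub>N\<^esub> n, x \<otimes>\<^bsub>N\<^esub> n') \<in> F h"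
    and up: "\<And>h y n n'. h \<in> carrier H \<Longrightarrow> y \<in> carrier H \<Longrightarrow> (n, n') \<in> F h \<Longrightarrow>
      (n, n') \<in> F (h \<otimes>\<^bsub>H\<^esub> y)"
    and act_rel: "\<And>h x n n'. h \<in> carrier H \<Longrightarrow> x \<in> carrier H \<Longrightarrow> (n, n') \<in> F h \<Longrightarrow>
      (\<phi> (x, n), \<phi> (x, n')) \<in> F (x \<otimes>\<^bsub>H\<^esub> h)"
    and act_mult: "\<And>h n n'. h \<in> carrier H \<Longrightarrow> n \<in> carrier N \<Longrightarrow> n' \<in> carrier N \<Longrightarrow>
      (\<phi> (h, n \<otimes>\<^bsub>N\<^esub> n'), \<phi> (h, n) \<otimes>\<^bsub>N\<^esub> \<phi> (h, n')) \<in> F h"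
    and act_assoc: "\<And>h h' n. h \<in> carrier H \<Longrightarrow> h' \<in> carrier H \<Longrightarrow> n \<in> carrier N \<Longrightarrow>
      (\<phi> (h \<otimes>\<^bsub>H\<^esub> h', n), \<phi> (h, \<phi> (h', n))) \<in> F (h \<otimes>\<^bsub>H\<^esub> h')"
    and act_one: "\<And>h. h \<in> carrier H \<Longrightarrow> (\<phi> (h, \<one>\<^bsub>N\<^esub>), \<one>\<^bsub>N\<^esub>) \<in> F h"
    and act_by_one: "\<And>n. n \<in> carrier N \<Longrightarrow> (\<phi> (\<one>\<^bsub>H\<^esub>, n), n) \<in> F \<one>\<^bsub>H\<^esub>"
  shows "compatible H N \<phi> (restrict F (carrier H))"
proof -
  interpret H: monoid H by fact
  interpret N: comm_group N by fact
  have rmult: "(n \<otimes>\<^bsub>N\<^esub> x, n' \<otimes>\<^bsub>N\<^esub> x) \<in> F h"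
    if "h \<in> carrier H" "n \<in> carrier N" "n' \<in> carrier N" "x \<in> carrier N" "(n, n') \<in> F h" for h n n' x
    using lmult[of h x n n'] that by (simp add: N.m_comm)
  show ?thesis
    unfolding compatible_def admissible_def indexed_equiv_def
    by (intro conjI ballI impI)
      (auto intro: act equiv one lmult up rmult act_rel act_mult act_assoc act_one act_by_one)
qed

lemma compatible_Inter:
  assumes "monoid H" and "comm_group N" and S: "S \<noteq> {}" "\<And>E. E \<in> S \<Longrightarrow> compatible H N \<phi> E"
  shows "compatible H N \<phi> (\<lambda>h\<in>carrier H. \<Inter>E\<in>S. E h)"
proof -
  interpret H: monoid H by fact
  interpret N: comm_group N by fact
  have fam: "compatible_family H N \<phi> E" if "E \<in> S" for E
    using assms that by (simp add: compatible_family_def compatible_family_axioms_def)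
  obtain E\<^sub>0 where E\<^sub>0: "E\<^sub>0 \<in> S" using S(1) by blast
  interpret E\<^sub>0: compatible_family H N \<phi> E\<^sub>0 by (rule fam[OF E\<^sub>0])
  show ?thesis
  proof (rule compatible_restrictI)
    fix h assume h: "h \<in> carrier H"
    have equiv: "equiv (carrier N) (E h)" if "E \<in> S" for E
      using compatible_family.rel_equiv[OF fam[OF that] h] .
    show "equiv (carrier N) (\<Inter>E\<in>S. E h)"
    proof (rule equivI)
      show "(\<Inter>E\<in>S. E h) \<subseteq> carrier N \<times> carrier N"
        using equiv_type[OF E\<^sub>0.rel_equiv[OF h]] E\<^sub>0 by blast
      show "refl_on (carrier N) (\<Inter>E\<in>S. E h)"
        using equiv by (auto simp: equiv_def refl_on_def)
      show "sym (\<Inter>E\<in>S. E h)"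
        using equiv by (intro sym_INTER) (simp add: equiv_def)
      show "trans (\<Inter>E\<in>S. E h)"
        using equiv by (intro trans_INTER) (simp add: equiv_def)
    qed
  next
    fix n n' assume "(n, n') \<in> (\<Inter>E\<in>S. E \<one>\<^bsub>H\<^esub>)"
    then show "n = n'"
      using E\<^sub>0 E\<^sub>0.rel_one_imp_eq by blast
  next
    show "\<phi> (h, n) \<in> carrier N" if "h \<in> carrier H" "n \<in> carrier N" for h n
      using that by (rule E\<^sub>0.act_closed)
  next
    fix h x n n' assume "h \<in> carrier H" "x \<in> carrier N" "(n, n') \<in> (\<Inter>E\<in>S. E h)"
    then show "(x \<otimes>\<^bsub>N\<^esub> n, x \<otimes>\<^bsub>N\<^esub> n') \<in> (\<Inter>E\<in>S. E h)"
      by (blast intro: compatible_family.rel_lmult[OF fam])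
  next
    fix h y n n' assume "h \<in> carrier H" "y \<in> carrier H" "(n, n') \<in> (\<Inter>E\<in>S. E h)"
    then show "(n, n') \<in> (\<Inter>E\<in>S. E (h \<otimes>\<^bsub>H\<^esub> y))"
      by (blast intro: compatible_family.rel_up[OF fam])
  next
    fix h x n n' assume "h \<in> carrier H" "x \<in> carrier H" "(n, n') \<in> (\<Inter>E\<in>S. E h)"
    then show "(\<phi> (x, n), \<phi> (x, n')) \<in> (\<Inter>E\<in>S. E (x \<otimes>\<^bsub>H\<^esub> h))"
      by (blast intro: compatible_family.act_rel[OF fam])
  qed (use assms(1,2) in \<open>blast intro: compatible_family.act_mult[OF fam]
      compatible_family.act_assoc[OF fam] compatible_family.act_one[OF fam]
      compatible_family.act_by_one[OF fam]\<close>)+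
qed

text \<open>
  If \<open>n \<sim>\<^sub>1 m \<sim>\<^sub>2 n'\<close>, each operation that preserves \<open>\<sim>\<^sub>1\<close> and \<open>\<sim>\<^sub>2\<close> can be applied to all three
  elements, so the closure conditions pass to the composition; the conditions that assert a relation
  between given elements already hold in \<open>E\<^sub>1\<close>. Symmetry and transitivity rest on the
  commutation of \<open>E\<^sub>1 h\<close> and \<open>E\<^sub>2 h\<close>.
\<close>

lemma compatible_relcomp:
  assumes "monoid H" and "comm_group N" and "compatible H N \<phi> E\<^sub>1" and "compatible H N \<phi> E\<^sub>2"
  shows "compatible H N \<phi> (\<lambda>h\<in>carrier H. E\<^sub>1 h O E\<^sub>2 h)"
proof -
  interpret H: monoid H by fact
  interpret N: comm_group N by fact
  interpret E\<^sub>1: compatible_family H N \<phi> E\<^sub>1 by unfold_locales fact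
  interpret E\<^sub>2: compatible_family H N \<phi> E\<^sub>2 by unfold_locales fact
  have sub1: "(a, b) \<in> E\<^sub>1 h O E\<^sub>2 h" if "h \<in> carrier H" "(a, b) \<in> E\<^sub>1 h" for h a b
    using E\<^sub>2.rel_refl[OF that(1) E\<^sub>1.rel_closed(2)[OF that]] that(2) by blast
  have commute: "(a, c) \<in> E\<^sub>1 h O E\<^sub>2 h"
    if h: "h \<in> carrier H" and ab: "(a, b) \<in> E\<^sub>2 h" and bc: "(b, c) \<in> E\<^sub>1 h" for h a b c
  proof -
    note cl = E\<^sub>2.rel_closed[OF h ab] E\<^sub>1.rel_closed[OF h bc]
    \<comment> \<open>In the square \<open>a, b, c\<close> the missing corner is \<open>d = a b\<^sup>-\<^sup>1 c\<close>: translating \<open>b \<sim>\<^sub>1 c\<close> by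
      \<open>a b\<^sup>-\<^sup>1\<close> gives \<open>a \<sim>\<^sub>1 d\<close>, and translating \<open>a \<sim>\<^sub>2 b\<close> by \<open>b\<^sup>-\<^sup>1 c\<close> gives \<open>d \<sim>\<^sub>2 c\<close>.\<close>
    define d where "d = a \<otimes>\<^bsub>N\<^esub> inv\<^bsub>N\<^esub> b \<otimes>\<^bsub>N\<^esub> c"
    have "a \<otimes>\<^bsub>N\<^esub> inv\<^bsub>N\<^esub> b \<otimes>\<^bsub>N\<^esub> b = a" "inv\<^bsub>N\<^esub> b \<otimes>\<^bsub>N\<^esub> c \<otimes>\<^bsub>N\<^esub> a = d" "inv\<^bsub>N\<^esub> b \<otimes>\<^bsub>N\<^esub> c \<otimes>\<^bsub>N\<^esub> b = c"
      using cl N.m_comm[of a "inv\<^bsub>N\<^esub> b \<otimes>\<^bsub>N\<^esub> c"] N.m_comm[of b "inv\<^bsub>N\<^esub> b \<otimes>\<^bsub>N\<^esub> c"]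
      by (simp_all add: d_def N.m_assoc) (simp add: N.m_assoc[symmetric])
    then show ?thesis
      using E\<^sub>1.rel_lmult[OF h _ bc, of "a \<otimes>\<^bsub>N\<^esub> inv\<^bsub>N\<^esub> b"] E\<^sub>2.rel_lmult[OF h _ ab, of "inv\<^bsub>N\<^esub> b \<otimes>\<^bsub>N\<^esub> c"] cl
      by (simp add: d_def[symmetric]) (rule relcompI)
  qed
  show ?thesis
  proof (rule compatible_restrictI)
    fix h assume h: "h \<in> carrier H"
    show "equiv (carrier N) (E\<^sub>1 h O E\<^sub>2 h)"
    proof (rule equivI)
      show "E\<^sub>1 h O E\<^sub>2 h \<subseteq> carrier N \<times> carrier N"
        using E\<^sub>1.rel_closed[OF h] E\<^sub>2.rel_closed[OF h] by blast
      show "refl_on (carrier N) (E\<^sub>1 h O E\<^sub>2 h)"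
        using E\<^sub>1.rel_refl[OF h] E\<^sub>2.rel_refl[OF h] by (meson refl_onI relcompI)
      show "sym (E\<^sub>1 h O E\<^sub>2 h)"
        by (rule symI) (blast intro: commute[OF h] E\<^sub>1.rel_sym[OF h] E\<^sub>2.rel_sym[OF h])
      show "trans (E\<^sub>1 h O E\<^sub>2 h)"
      proof (rule transI)
        fix a b c assume "(a, b) \<in> E\<^sub>1 h O E\<^sub>2 h" "(b, c) \<in> E\<^sub>1 h O E\<^sub>2 h"
        then obtain u v where "(a, u) \<in> E\<^sub>1 h" "(u, b) \<in> E\<^sub>2 h" "(b, v) \<in> E\<^sub>1 h" "(v, c) \<in> E\<^sub>2 h"
          by blast
        moreover obtain w where "(u, w) \<in> E\<^sub>1 h" "(w, v) \<in> E\<^sub>2 h"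
          using commute[OF h \<open>(u, b) \<in> E\<^sub>2 h\<close> \<open>(b, v) \<in> E\<^sub>1 h\<close>] by blast
        ultimately show "(a, c) \<in> E\<^sub>1 h O E\<^sub>2 h"
          using E\<^sub>1.rel_trans[OF h] E\<^sub>2.rel_trans[OF h] by blast
      qed
    qed
  next
    fix n n' assume "(n, n') \<in> E\<^sub>1 \<one>\<^bsub>H\<^esub> O E\<^sub>2 \<one>\<^bsub>H\<^esub>"
    then show "n = n'"
      by (auto dest!: E\<^sub>1.rel_one_imp_eq E\<^sub>2.rel_one_imp_eq)
  next
    fix h x n n' assume h: "h \<in> carrier H" "x \<in> carrier N" and "(n, n') \<in> E\<^sub>1 h O E\<^sub>2 h"
    then obtain m where "(n, m) \<in> E\<^sub>1 h" "(m, n') \<in> E\<^sub>2 h"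
      by blast
    with h show "(x \<otimes>\<^bsub>N\<^esub> n, x \<otimes>\<^bsub>N\<^esub> n') \<in> E\<^sub>1 h O E\<^sub>2 h"
      by (intro relcompI) (rule E\<^sub>1.rel_lmult E\<^sub>2.rel_lmult; assumption)+
  next
    fix h y n n' assume h: "h \<in> carrier H" "y \<in> carrier H" and "(n, n') \<in> E\<^sub>1 h O E\<^sub>2 h"
    then obtain m where "(n, m) \<in> E\<^sub>1 h" "(m, n') \<in> E\<^sub>2 h"
      by blast
    with h show "(n, n') \<in> E\<^sub>1 (h \<otimes>\<^bsub>H\<^esub> y) O E\<^sub>2 (h \<otimes>\<^bsub>H\<^esub> y)"
      by (intro relcompI) (rule E\<^sub>1.rel_up E\<^sub>2.rel_up; assumption)+
  next
    fix h x n n' assume h: "h \<in> carrier H" "x \<in> carrier H" and "(n, n') \<in> E\<^sub>1 h O E\<^sub>2 h"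
    then obtain m where "(n, m) \<in> E\<^sub>1 h" "(m, n') \<in> E\<^sub>2 h"
      by blast
    with h show "(\<phi> (x, n), \<phi> (x, n')) \<in> E\<^sub>1 (x \<otimes>\<^bsub>H\<^esub> h) O E\<^sub>2 (x \<otimes>\<^bsub>H\<^esub> h)"
      by (intro relcompI) (rule E\<^sub>1.act_rel E\<^sub>2.act_rel; assumption)+
  qed (simp_all add: assms(1,2) sub1 E\<^sub>1.act_closed E\<^sub>1.act_mult E\<^sub>1.act_assoc E\<^sub>1.act_one
      E\<^sub>1.act_by_one)
qed

lemma compatible_order_simps [simp]:
  "carrier (compatible_order H N \<phi>) = {E. compatible H N \<phi> E}"
  "(E .=\<^bsub>compatible_order H N \<phi>\<^esub> E') = (E = E')"
  "(E \<sqsubseteq>\<^bsub>compatible_order H N \<phi>\<^esub> E') = (\<forall>h\<in>carrier H. E h \<subseteq> E' h)"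
  by (simp_all add: compatible_order_def)

lemma partial_order_compatible: "partial_order (compatible_order H N \<phi>)"
proof
  fix E E' assume E: "E \<in> carrier (compatible_order H N \<phi>)" "E' \<in> carrier (compatible_order H N \<phi>)"
    "E \<sqsubseteq>\<^bsub>compatible_order H N \<phi>\<^esub> E'" "E' \<sqsubseteq>\<^bsub>compatible_order H N \<phi>\<^esub> E"
  then have ext: "E \<in> extensional (carrier H)" "E' \<in> extensional (carrier H)"
    by (simp_all add: compatible_def admissible_def indexed_equiv_def)
  have "E h = E' h" if "h \<in> carrier H" for h
    using E(3,4) that by (simp add: set_eq_subset)
  with extensionalityI[OF ext] show "E .=\<^bsub>compatible_order H N \<phi>\<^esub> E'"
    by simp
next
  show "(.=\<^bsub>compatible_order H N \<phi>\<^esub>) = (=)"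
    by (intro ext) simp
qed auto

text \<open>
  The composition of \<open>E\<^sub>1\<close> and \<open>E\<^sub>2\<close> contains both by reflexivity, and lies in every compatible
  family above both by transitivity of the latter.
\<close>

lemma upper_semilattice_compatible:
  assumes H: "monoid H" and N: "comm_group N"
  shows "upper_semilattice (compatible_order H N \<phi>)"
proof -
  interpret partial_order "compatible_order H N \<phi>" by (rule partial_order_compatible)
  show ?thesis
  proof
    fix E\<^sub>1 E\<^sub>2
    assume "E\<^sub>1 \<in> carrier (compatible_order H N \<phi>)" "E\<^sub>2 \<in> carrier (compatible_order H N \<phi>)"
    then have c: "compatible H N \<phi> E\<^sub>1" "compatible H N \<phi> E\<^sub>2" by auto
    interpret E\<^sub>1: compatible_family H N \<phi> E\<^sub>1
      using assms c by (simp add: compatible_family_def compatible_family_axioms_def)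
    interpret E\<^sub>2: compatible_family H N \<phi> E\<^sub>2 by unfold_locales fact
    have "least (compatible_order H N \<phi>) (\<lambda>h\<in>carrier H. E\<^sub>1 h O E\<^sub>2 h)
            (Upper (compatible_order H N \<phi>) {E\<^sub>1, E\<^sub>2})"
    proof (rule least_UpperI)
      fix E assume "E \<in> {E\<^sub>1, E\<^sub>2}"
      then show "E \<sqsubseteq>\<^bsub>compatible_order H N \<phi>\<^esub> (\<lambda>h\<in>carrier H. E\<^sub>1 h O E\<^sub>2 h)"
        using E\<^sub>1.rel_refl[OF _ E\<^sub>2.rel_closed(1)] E\<^sub>2.rel_refl[OF _ E\<^sub>1.rel_closed(2)]
        by (simp add: subset_iff) blast
    next
      fix E assume "E \<in> Upper (compatible_order H N \<phi>) {E\<^sub>1, E\<^sub>2}"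
      then have "compatible H N \<phi> E" and le: "\<And>h. h \<in> carrier H \<Longrightarrow> E\<^sub>1 h \<subseteq> E h \<and> E\<^sub>2 h \<subseteq> E h"
        using c by (auto simp: Upper_def)
      then interpret E: compatible_family H N \<phi> E by unfold_locales
      show "(\<lambda>h\<in>carrier H. E\<^sub>1 h O E\<^sub>2 h) \<sqsubseteq>\<^bsub>compatible_order H N \<phi>\<^esub> E"
        using le by (simp add: subset_iff) (blast intro: E.rel_trans)
    qed (use c compatible_relcomp[OF H N] in auto)
    then show "\<exists>s. least (compatible_order H N \<phi>) s (Upper (compatible_order H N \<phi>) {E\<^sub>1, E\<^sub>2})"
      by blast
  qed
qed

text \<open>
  Validity of \<open>\<phi>\<close> is what makes the intersection of all compatible families one over a nonempty
  index set.
\<close>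

lemma weak_partial_order_bottom_compatible:
  assumes H: "monoid H" and N: "comm_group N" and "valid_action H N \<phi>"
  shows "weak_partial_order_bottom (compatible_order H N \<phi>)"
proof -
  interpret partial_order "compatible_order H N \<phi>" by (rule partial_order_compatible)
  have "compatible H N \<phi> (\<lambda>h\<in>carrier H. \<Inter>E\<in>{E. compatible H N \<phi> E}. E h)"
    using assms by (intro compatible_Inter) (auto simp: valid_action_def)
  then have "least (compatible_order H N \<phi>) (\<lambda>h\<in>carrier H. \<Inter>E\<in>{E. compatible H N \<phi> E}. E h)
      (carrier (compatible_order H N \<phi>))"
    by (auto simp: least_def)
  then show ?thesis
    by unfold_locales blast
qed


section \<open>Factor sets modulo a compatible family\<close>

context compatible_family
begin

lemma factor_setsI:
  assumes "g \<in> carrier H \<times> carrier H \<rightarrow>\<^sub>E carrier N"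
    and "\<And>h. h \<in> carrier H \<Longrightarrow> (g (h, \<one>\<^bsub>H\<^esub>), \<one>\<^bsub>N\<^esub>) \<in> E h"
    and "\<And>h. h \<in> carrier H \<Longrightarrow> (g (\<one>\<^bsub>H\<^esub>, h), \<one>\<^bsub>N\<^esub>) \<in> E h"
    and "\<And>x y z. x \<in> carrier H \<Longrightarrow> y \<in> carrier H \<Longrightarrow> z \<in> carrier H \<Longrightarrow>
      (g (x, y) \<otimes>\<^bsub>N\<^esub> g (x \<otimes>\<^bsub>H\<^esub> y, z), \<phi> (x, g (y, z)) \<otimes>\<^bsub>N\<^esub> g (x, y \<otimes>\<^bsub>H\<^esub> z))
        \<in> E (x \<otimes>\<^bsub>H\<^esub> y \<otimes>\<^bsub>H\<^esub> z)"
  shows "g \<in> factor_sets H N E \<phi>"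
  using assms(1,2,4) rel_sym[OF _ assms(3)] by (simp add: factor_sets_def)

lemma factor_sets_ext:
  "g \<in> factor_sets H N E \<phi> \<Longrightarrow> g \<in> carrier H \<times> carrier H \<rightarrow>\<^sub>E carrier N"
  by (simp add: factor_sets_def)

lemma factor_sets_closed:
  "g \<in> factor_sets H N E \<phi> \<Longrightarrow> x \<in> carrier H \<Longrightarrow> y \<in> carrier H \<Longrightarrow> g (x, y) \<in> carrier N"
  by (auto simp: factor_sets_def)

lemma factor_sets_normalized:
  assumes "g \<in> factor_sets H N E \<phi>" "h \<in> carrier H"
  shows "(g (h, \<one>\<^bsub>H\<^esub>), \<one>\<^bsub>N\<^esub>) \<in> E h" "(g (\<one>\<^bsub>H\<^esub>, h), \<one>\<^bsub>N\<^esub>) \<in> E h"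
  using assms rel_sym[of h "\<one>\<^bsub>N\<^esub>" "g (\<one>\<^bsub>H\<^esub>, h)"] by (simp_all add: factor_sets_def)

lemma factor_sets_cocycle:
  "g \<in> factor_sets H N E \<phi> \<Longrightarrow> x \<in> carrier H \<Longrightarrow> y \<in> carrier H \<Longrightarrow> z \<in> carrier H \<Longrightarrow>
   (g (x, y) \<otimes>\<^bsub>N\<^esub> g (x \<otimes>\<^bsub>H\<^esub> y, z), \<phi> (x, g (y, z)) \<otimes>\<^bsub>N\<^esub> g (x, y \<otimes>\<^bsub>H\<^esub> z))
     \<in> E (x \<otimes>\<^bsub>H\<^esub> y \<otimes>\<^bsub>H\<^esub> z)"
  by (simp add: factor_sets_def)

lemma factor_one_in: "factor_one H N \<in> factor_sets H N E \<phi>"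
proof (rule factor_setsI)
  fix x y z assume h: "x \<in> carrier H" "y \<in> carrier H" "z \<in> carrier H"
  have "(\<one>\<^bsub>N\<^esub>, \<phi> (x, \<one>\<^bsub>N\<^esub>)) \<in> E (x \<otimes>\<^bsub>H\<^esub> (y \<otimes>\<^bsub>H\<^esub> z))"
    using rel_up[OF _ _ rel_sym[OF _ act_one]] h by simp
  then show "(factor_one H N (x, y) \<otimes>\<^bsub>N\<^esub> factor_one H N (x \<otimes>\<^bsub>H\<^esub> y, z),
      \<phi> (x, factor_one H N (y, z)) \<otimes>\<^bsub>N\<^esub> factor_one H N (x, y \<otimes>\<^bsub>H\<^esub> z)) \<in> E (x \<otimes>\<^bsub>H\<^esub> y \<otimes>\<^bsub>H\<^esub> z)"
    using h act_closed[of x "\<one>\<^bsub>N\<^esub>"] by (simp add: factor_one_def H.m_assoc)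
qed (auto simp: factor_one_def rel_refl)

lemma mult_interchange:
  assumes "a \<in> carrier N" "b \<in> carrier N" "c \<in> carrier N" "d \<in> carrier N"
  shows "(a \<otimes>\<^bsub>N\<^esub> b) \<otimes>\<^bsub>N\<^esub> (c \<otimes>\<^bsub>N\<^esub> d) = (a \<otimes>\<^bsub>N\<^esub> c) \<otimes>\<^bsub>N\<^esub> (b \<otimes>\<^bsub>N\<^esub> d)"
  using assms by (simp add: N.m_assoc N.m_lcomm[of b c d])

text \<open>
  Multiply the two cocycle identities; the factor \<open>\<phi> (x, u) \<phi> (x, v)\<close> that arises is related to
  \<open>\<phi> (x, u v)\<close> by \<open>\<sim>\<^sup>x\<close>, hence by \<open>\<sim>\<^sup>x\<^sup>y\<^sup>z\<close>.
\<close>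

lemma factor_mult_in:
  assumes g: "g \<in> factor_sets H N E \<phi>" and g': "g' \<in> factor_sets H N E \<phi>"
  shows "factor_mult H N g g' \<in> factor_sets H N E \<phi>"
proof (rule factor_setsI)
  note cl = factor_sets_closed[OF g] factor_sets_closed[OF g']
  show "factor_mult H N g g' \<in> carrier H \<times> carrier H \<rightarrow>\<^sub>E carrier N"
    using cl by (auto simp: factor_mult_def)
  show "(factor_mult H N g g' (h, \<one>\<^bsub>H\<^esub>), \<one>\<^bsub>N\<^esub>) \<in> E h" "(factor_mult H N g g' (\<one>\<^bsub>H\<^esub>, h), \<one>\<^bsub>N\<^esub>) \<in> E h"
    if h: "h \<in> carrier H" for h
    using rel_mult[OF h factor_sets_normalized(1)[OF g h] factor_sets_normalized(1)[OF g' h]]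
      rel_mult[OF h factor_sets_normalized(2)[OF g h] factor_sets_normalized(2)[OF g' h]] h
    by (simp_all add: factor_mult_def)
  fix x y z assume h: "x \<in> carrier H" "y \<in> carrier H" "z \<in> carrier H"
  define u v where "u = g (y, z)" and "v = g' (y, z)"
  have uv: "u \<in> carrier N" "v \<in> carrier N" "\<phi> (x, u) \<in> carrier N" "\<phi> (x, v) \<in> carrier N"
    "\<phi> (x, u \<otimes>\<^bsub>N\<^esub> v) \<in> carrier N"
    using cl h act_closed unfolding u_def v_def by auto
  have xyz: "x \<otimes>\<^bsub>H\<^esub> y \<otimes>\<^bsub>H\<^esub> z \<in> carrier H" using h by simp
  have gcl: "g (x, y) \<in> carrier N" "g (x \<otimes>\<^bsub>H\<^esub> y, z) \<in> carrier N" "g (x, y \<otimes>\<^bsub>H\<^esub> z) \<in> carrier N"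
    "g' (x, y) \<in> carrier N" "g' (x \<otimes>\<^bsub>H\<^esub> y, z) \<in> carrier N" "g' (x, y \<otimes>\<^bsub>H\<^esub> z) \<in> carrier N"
    using cl h by simp_all
  have "(g (x, y) \<otimes>\<^bsub>N\<^esub> g' (x, y) \<otimes>\<^bsub>N\<^esub> (g (x \<otimes>\<^bsub>H\<^esub> y, z) \<otimes>\<^bsub>N\<^esub> g' (x \<otimes>\<^bsub>H\<^esub> y, z)),
      (\<phi> (x, u) \<otimes>\<^bsub>N\<^esub> \<phi> (x, v)) \<otimes>\<^bsub>N\<^esub> (g (x, y \<otimes>\<^bsub>H\<^esub> z) \<otimes>\<^bsub>N\<^esub> g' (x, y \<otimes>\<^bsub>H\<^esub> z))) \<in> E (x \<otimes>\<^bsub>H\<^esub> y \<otimes>\<^bsub>H\<^esub> z)"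
    using rel_mult[OF xyz factor_sets_cocycle[OF g h] factor_sets_cocycle[OF g' h]]
      mult_interchange[OF gcl(1,2,4,5)] mult_interchange[OF uv(3) gcl(3) uv(4) gcl(6)]
    by (simp add: u_def v_def)
  moreover have "(\<phi> (x, u) \<otimes>\<^bsub>N\<^esub> \<phi> (x, v), \<phi> (x, u \<otimes>\<^bsub>N\<^esub> v)) \<in> E (x \<otimes>\<^bsub>H\<^esub> y \<otimes>\<^bsub>H\<^esub> z)"
    using rel_up[OF h(1) _ rel_sym[OF h(1) act_mult[OF h(1) uv(1,2)]], of "y \<otimes>\<^bsub>H\<^esub> z"] h
    by (simp add: H.m_assoc)
  from rel_mult[OF xyz this rel_refl[OF xyz], of "g (x, y \<otimes>\<^bsub>H\<^esub> z) \<otimes>\<^bsub>N\<^esub> g' (x, y \<otimes>\<^bsub>H\<^esub> z)"]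
  have "((\<phi> (x, u) \<otimes>\<^bsub>N\<^esub> \<phi> (x, v)) \<otimes>\<^bsub>N\<^esub> (g (x, y \<otimes>\<^bsub>H\<^esub> z) \<otimes>\<^bsub>N\<^esub> g' (x, y \<otimes>\<^bsub>H\<^esub> z)),
      \<phi> (x, u \<otimes>\<^bsub>N\<^esub> v) \<otimes>\<^bsub>N\<^esub> (g (x, y \<otimes>\<^bsub>H\<^esub> z) \<otimes>\<^bsub>N\<^esub> g' (x, y \<otimes>\<^bsub>H\<^esub> z))) \<in> E (x \<otimes>\<^bsub>H\<^esub> y \<otimes>\<^bsub>H\<^esub> z)"
    using gcl by simp
  ultimately have "(g (x, y) \<otimes>\<^bsub>N\<^esub> g' (x, y) \<otimes>\<^bsub>N\<^esub> (g (x \<otimes>\<^bsub>H\<^esub> y, z) \<otimes>\<^bsub>N\<^esub> g' (x \<otimes>\<^bsub>H\<^esub> y, z)),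
      \<phi> (x, u \<otimes>\<^bsub>N\<^esub> v) \<otimes>\<^bsub>N\<^esub> (g (x, y \<otimes>\<^bsub>H\<^esub> z) \<otimes>\<^bsub>N\<^esub> g' (x, y \<otimes>\<^bsub>H\<^esub> z))) \<in> E (x \<otimes>\<^bsub>H\<^esub> y \<otimes>\<^bsub>H\<^esub> z)"
    by (rule rel_trans[OF xyz])
  then show "(factor_mult H N g g' (x, y) \<otimes>\<^bsub>N\<^esub> factor_mult H N g g' (x \<otimes>\<^bsub>H\<^esub> y, z),
      \<phi> (x, factor_mult H N g g' (y, z)) \<otimes>\<^bsub>N\<^esub> factor_mult H N g g' (x, y \<otimes>\<^bsub>H\<^esub> z))
      \<in> E (x \<otimes>\<^bsub>H\<^esub> y \<otimes>\<^bsub>H\<^esub> z)"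
    using h by (simp add: factor_mult_def u_def v_def)
qed

lemma factor_inv_in:
  assumes g: "g \<in> factor_sets H N E \<phi>"
  shows "factor_inv H N g \<in> factor_sets H N E \<phi>"
proof (rule factor_setsI)
  note cl = factor_sets_closed[OF g]
  show "factor_inv H N g \<in> carrier H \<times> carrier H \<rightarrow>\<^sub>E carrier N"
    using cl by (auto simp: factor_inv_def)
  show "(factor_inv H N g (h, \<one>\<^bsub>H\<^esub>), \<one>\<^bsub>N\<^esub>) \<in> E h" "(factor_inv H N g (\<one>\<^bsub>H\<^esub>, h), \<one>\<^bsub>N\<^esub>) \<in> E h"
    if h: "h \<in> carrier H" for h
    using rel_inv[OF h factor_sets_normalized(1)[OF g h]]
      rel_inv[OF h factor_sets_normalized(2)[OF g h]] h
    by (simp_all add: factor_inv_def)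
  fix x y z assume h: "x \<in> carrier H" "y \<in> carrier H" "z \<in> carrier H"
  define u where "u = g (y, z)"
  have u: "u \<in> carrier N" "\<phi> (x, u) \<in> carrier N" "\<phi> (x, inv\<^bsub>N\<^esub> u) \<in> carrier N"
    using cl h act_closed unfolding u_def by auto
  have xyz: "x \<otimes>\<^bsub>H\<^esub> y \<otimes>\<^bsub>H\<^esub> z \<in> carrier H" using h by simp
  have gcl: "g (x, y) \<in> carrier N" "g (x \<otimes>\<^bsub>H\<^esub> y, z) \<in> carrier N" "g (x, y \<otimes>\<^bsub>H\<^esub> z) \<in> carrier N"
    using cl h by simp_all
  have "(inv\<^bsub>N\<^esub> g (x, y) \<otimes>\<^bsub>N\<^esub> inv\<^bsub>N\<^esub> g (x \<otimes>\<^bsub>H\<^esub> y, z),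
      inv\<^bsub>N\<^esub> \<phi> (x, u) \<otimes>\<^bsub>N\<^esub> inv\<^bsub>N\<^esub> g (x, y \<otimes>\<^bsub>H\<^esub> z)) \<in> E (x \<otimes>\<^bsub>H\<^esub> y \<otimes>\<^bsub>H\<^esub> z)"
    using rel_inv[OF xyz factor_sets_cocycle[OF g h]] gcl u by (simp add: u_def N.inv_mult)
  moreover have "(inv\<^bsub>N\<^esub> \<phi> (x, u), \<phi> (x, inv\<^bsub>N\<^esub> u)) \<in> E (x \<otimes>\<^bsub>H\<^esub> y \<otimes>\<^bsub>H\<^esub> z)"
    using rel_up[OF h(1) _ rel_sym[OF h(1) act_inv[OF h(1) u(1)]], of "y \<otimes>\<^bsub>H\<^esub> z"] h
    by (simp add: H.m_assoc)
  from rel_mult[OF xyz this rel_refl[OF xyz], of "inv\<^bsub>N\<^esub> g (x, y \<otimes>\<^bsub>H\<^esub> z)"]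
  have "(inv\<^bsub>N\<^esub> \<phi> (x, u) \<otimes>\<^bsub>N\<^esub> inv\<^bsub>N\<^esub> g (x, y \<otimes>\<^bsub>H\<^esub> z),
      \<phi> (x, inv\<^bsub>N\<^esub> u) \<otimes>\<^bsub>N\<^esub> inv\<^bsub>N\<^esub> g (x, y \<otimes>\<^bsub>H\<^esub> z)) \<in> E (x \<otimes>\<^bsub>H\<^esub> y \<otimes>\<^bsub>H\<^esub> z)"
    using gcl by simp
  ultimately have "(inv\<^bsub>N\<^esub> g (x, y) \<otimes>\<^bsub>N\<^esub> inv\<^bsub>N\<^esub> g (x \<otimes>\<^bsub>H\<^esub> y, z),
      \<phi> (x, inv\<^bsub>N\<^esub> u) \<otimes>\<^bsub>N\<^esub> inv\<^bsub>N\<^esub> g (x, y \<otimes>\<^bsub>H\<^esub> z)) \<in> E (x \<otimes>\<^bsub>H\<^esub> y \<otimes>\<^bsub>H\<^esub> z)"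
    by (rule rel_trans[OF xyz])
  then show "(factor_inv H N g (x, y) \<otimes>\<^bsub>N\<^esub> factor_inv H N g (x \<otimes>\<^bsub>H\<^esub> y, z),
      \<phi> (x, factor_inv H N g (y, z)) \<otimes>\<^bsub>N\<^esub> factor_inv H N g (x, y \<otimes>\<^bsub>H\<^esub> z))
      \<in> E (x \<otimes>\<^bsub>H\<^esub> y \<otimes>\<^bsub>H\<^esub> z)"
    using h by (simp add: factor_inv_def u_def)
qed

lemma coboundary_closed:
  assumes "t \<in> carrier H \<rightarrow> carrier N" "h \<in> carrier H" "h' \<in> carrier H"
  shows "coboundary H N \<phi> t (h, h') \<in> carrier N"
  using assms act_closed by (auto simp: coboundary_def Pi_iff)

text \<open>
  The next three lemmas say that \<open>t \<mapsto> \<delta>t\<close> is a homomorphism up to \<open>\<sim>\<^sup>h\<^sup>h\<^sup>'\<close>. They yield, in this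
  order, reflexivity, transitivity and symmetry of \<open>\<equiv>\<close>.
\<close>

lemma coboundary_one:
  assumes "h \<in> carrier H" "h' \<in> carrier H"
  shows "(coboundary H N \<phi> (\<lambda>_. \<one>\<^bsub>N\<^esub>) (h, h'), \<one>\<^bsub>N\<^esub>) \<in> E (h \<otimes>\<^bsub>H\<^esub> h')"
  using rel_up[OF _ _ act_one] act_closed[of h "\<one>\<^bsub>N\<^esub>"] assms by (simp add: coboundary_def)

lemma coboundary_mult:
  assumes t: "t \<in> carrier H \<rightarrow> carrier N" and s: "s \<in> carrier H \<rightarrow> carrier N"
    and h: "h \<in> carrier H" "h' \<in> carrier H"
  shows "(coboundary H N \<phi> (\<lambda>x. t x \<otimes>\<^bsub>N\<^esub> s x) (h, h'),
      coboundary H N \<phi> t (h, h') \<otimes>\<^bsub>N\<^esub> coboundary H N \<phi> s (h, h')) \<in> E (h \<otimes>\<^bsub>H\<^esub> h')"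
proof -
  have hh': "h \<otimes>\<^bsub>H\<^esub> h' \<in> carrier H" using h by simp
  define r where "r = (\<lambda>t. inv\<^bsub>N\<^esub> t (h \<otimes>\<^bsub>H\<^esub> h') \<otimes>\<^bsub>N\<^esub> t h)"
  have cl: "t h \<in> carrier N" "t h' \<in> carrier N" "t (h \<otimes>\<^bsub>H\<^esub> h') \<in> carrier N"
    "s h \<in> carrier N" "s h' \<in> carrier N" "s (h \<otimes>\<^bsub>H\<^esub> h') \<in> carrier N"
    "\<phi> (h, t h') \<in> carrier N" "\<phi> (h, s h') \<in> carrier N" "\<phi> (h, t h' \<otimes>\<^bsub>N\<^esub> s h') \<in> carrier N"
    using t s h hh' act_closed by (auto simp: Pi_iff)
  have rc: "r t \<in> carrier N" "r s \<in> carrier N" using cl by (auto simp: r_def)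
  have "(\<phi> (h, t h' \<otimes>\<^bsub>N\<^esub> s h') \<otimes>\<^bsub>N\<^esub> (r t \<otimes>\<^bsub>N\<^esub> r s),
      (\<phi> (h, t h') \<otimes>\<^bsub>N\<^esub> \<phi> (h, s h')) \<otimes>\<^bsub>N\<^esub> (r t \<otimes>\<^bsub>N\<^esub> r s)) \<in> E (h \<otimes>\<^bsub>H\<^esub> h')"
    using rel_mult[OF hh' rel_up[OF h act_mult] rel_refl[OF hh']] h cl rc by simp
  then show ?thesis
    using h cl by (simp add: coboundary_def r_def N.inv_mult N.m_ac)
qed

lemma coboundary_inv:
  assumes t: "t \<in> carrier H \<rightarrow> carrier N" and h: "h \<in> carrier H" "h' \<in> carrier H"
  shows "(coboundary H N \<phi> (\<lambda>x. inv\<^bsub>N\<^esub> t x) (h, h'), inv\<^bsub>N\<^esub> coboundary H N \<phi> t (h, h'))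
      \<in> E (h \<otimes>\<^bsub>H\<^esub> h')"
proof -
  have hh': "h \<otimes>\<^bsub>H\<^esub> h' \<in> carrier H" using h by simp
  have cl: "t h \<in> carrier N" "t h' \<in> carrier N" "t (h \<otimes>\<^bsub>H\<^esub> h') \<in> carrier N"
    "\<phi> (h, t h') \<in> carrier N" "\<phi> (h, inv\<^bsub>N\<^esub> t h') \<in> carrier N"
    using t h hh' act_closed by (auto simp: Pi_iff)
  have "(\<phi> (h, inv\<^bsub>N\<^esub> t h') \<otimes>\<^bsub>N\<^esub> (t (h \<otimes>\<^bsub>H\<^esub> h') \<otimes>\<^bsub>N\<^esub> inv\<^bsub>N\<^esub> t h),
      inv\<^bsub>N\<^esub> \<phi> (h, t h') \<otimes>\<^bsub>N\<^esub> (t (h \<otimes>\<^bsub>H\<^esub> h') \<otimes>\<^bsub>N\<^esub> inv\<^bsub>N\<^esub> t h)) \<in> E (h \<otimes>\<^bsub>H\<^esub> h')"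
    using rel_mult[OF hh' rel_up[OF h act_inv] rel_refl[OF hh']] h cl by simp
  then show ?thesis
    using h cl by (simp add: coboundary_def N.inv_mult N.m_assoc)
qed

lemma cohomologousI:
  assumes "g \<in> factor_sets H N E \<phi>" "g' \<in> factor_sets H N E \<phi>"
    and "t \<in> carrier H \<rightarrow> carrier N" "t \<one>\<^bsub>H\<^esub> = \<one>\<^bsub>N\<^esub>"
    and "\<And>h h'. h \<in> carrier H \<Longrightarrow> h' \<in> carrier H \<Longrightarrow>
      (coboundary H N \<phi> t (h, h') \<otimes>\<^bsub>N\<^esub> g' (h, h'), g (h, h')) \<in> E (h \<otimes>\<^bsub>H\<^esub> h')"
  shows "(g, g') \<in> cohomologous H N E \<phi>"
  using assms unfolding cohomologous_def inner_factor_sets_def by blast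

lemma cohomologousE:
  assumes "(g, g') \<in> cohomologous H N E \<phi>"
  obtains t where "g \<in> factor_sets H N E \<phi>" "g' \<in> factor_sets H N E \<phi>"
    "t \<in> carrier H \<rightarrow> carrier N" "t \<one>\<^bsub>H\<^esub> = \<one>\<^bsub>N\<^esub>"
    "\<And>h h'. h \<in> carrier H \<Longrightarrow> h' \<in> carrier H \<Longrightarrow>
      (coboundary H N \<phi> t (h, h') \<otimes>\<^bsub>N\<^esub> g' (h, h'), g (h, h')) \<in> E (h \<otimes>\<^bsub>H\<^esub> h')"
  using assms unfolding cohomologous_def inner_factor_sets_def by blast

lemma cohomologous_refl:
  assumes g: "g \<in> factor_sets H N E \<phi>"
  shows "(g, g) \<in> cohomologous H N E \<phi>"
proof (rule cohomologousI[OF g g, of "\<lambda>_. \<one>\<^bsub>N\<^esub>"])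
  fix h h' assume h: "h \<in> carrier H" "h' \<in> carrier H"
  then show "(coboundary H N \<phi> (\<lambda>_. \<one>\<^bsub>N\<^esub>) (h, h') \<otimes>\<^bsub>N\<^esub> g (h, h'), g (h, h')) \<in> E (h \<otimes>\<^bsub>H\<^esub> h')"
    using rel_mult[OF _ coboundary_one[OF h] rel_refl, of "g (h, h')"] factor_sets_closed[OF g h]
    by simp
qed auto

lemma cohomologous_sym:
  assumes "(g, g') \<in> cohomologous H N E \<phi>"
  shows "(g', g) \<in> cohomologous H N E \<phi>"
proof -
  obtain t where g: "g \<in> factor_sets H N E \<phi>" "g' \<in> factor_sets H N E \<phi>"
    and t: "t \<in> carrier H \<rightarrow> carrier N" "t \<one>\<^bsub>H\<^esub> = \<one>\<^bsub>N\<^esub>"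
    and rel: "\<And>h h'. h \<in> carrier H \<Longrightarrow> h' \<in> carrier H \<Longrightarrow>
      (coboundary H N \<phi> t (h, h') \<otimes>\<^bsub>N\<^esub> g' (h, h'), g (h, h')) \<in> E (h \<otimes>\<^bsub>H\<^esub> h')"
    using assms by (rule cohomologousE) blast
  show ?thesis
  proof (rule cohomologousI[OF g(2,1), of "\<lambda>x. inv\<^bsub>N\<^esub> t x"])
    fix h h' assume h: "h \<in> carrier H" "h' \<in> carrier H"
    have hh': "h \<otimes>\<^bsub>H\<^esub> h' \<in> carrier H" using h by simp
    have cl: "g (h, h') \<in> carrier N" "g' (h, h') \<in> carrier N" "coboundary H N \<phi> t (h, h') \<in> carrier N"
      using factor_sets_closed g h coboundary_closed t by auto
    have "(coboundary H N \<phi> (\<lambda>x. inv\<^bsub>N\<^esub> t x) (h, h') \<otimes>\<^bsub>N\<^esub> g (h, h'),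
        inv\<^bsub>N\<^esub> coboundary H N \<phi> t (h, h') \<otimes>\<^bsub>N\<^esub> (coboundary H N \<phi> t (h, h') \<otimes>\<^bsub>N\<^esub> g' (h, h')))
        \<in> E (h \<otimes>\<^bsub>H\<^esub> h')"
      by (rule rel_mult[OF hh' coboundary_inv[OF t(1) h] rel_sym[OF hh' rel[OF h]]])
    then show "(coboundary H N \<phi> (\<lambda>x. inv\<^bsub>N\<^esub> t x) (h, h') \<otimes>\<^bsub>N\<^esub> g (h, h'), g' (h, h')) \<in> E (h \<otimes>\<^bsub>H\<^esub> h')"
      using cl by (simp add: N.m_assoc[symmetric])
  qed (use t in auto)
qed

lemma cohomologous_trans:
  assumes "(g, g') \<in> cohomologous H N E \<phi>" "(g', g'') \<in> cohomologous H N E \<phi>"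
  shows "(g, g'') \<in> cohomologous H N E \<phi>"
proof -
  obtain t where g: "g \<in> factor_sets H N E \<phi>" "g' \<in> factor_sets H N E \<phi>"
    and t: "t \<in> carrier H \<rightarrow> carrier N" "t \<one>\<^bsub>H\<^esub> = \<one>\<^bsub>N\<^esub>"
    and relt: "\<And>h h'. h \<in> carrier H \<Longrightarrow> h' \<in> carrier H \<Longrightarrow>
      (coboundary H N \<phi> t (h, h') \<otimes>\<^bsub>N\<^esub> g' (h, h'), g (h, h')) \<in> E (h \<otimes>\<^bsub>H\<^esub> h')"
    using assms(1) by (rule cohomologousE) blast
  obtain s where g'': "g'' \<in> factor_sets H N E \<phi>"
    and s: "s \<in> carrier H \<rightarrow> carrier N" "s \<one>\<^bsub>H\<^esub> = \<one>\<^bsub>N\<^esub>"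
    and rels: "\<And>h h'. h \<in> carrier H \<Longrightarrow> h' \<in> carrier H \<Longrightarrow>
      (coboundary H N \<phi> s (h, h') \<otimes>\<^bsub>N\<^esub> g'' (h, h'), g' (h, h')) \<in> E (h \<otimes>\<^bsub>H\<^esub> h')"
    using assms(2) by (rule cohomologousE) blast
  show ?thesis
  proof (rule cohomologousI[OF g(1) g'', of "\<lambda>x. t x \<otimes>\<^bsub>N\<^esub> s x"])
    fix h h' assume h: "h \<in> carrier H" "h' \<in> carrier H"
    have hh': "h \<otimes>\<^bsub>H\<^esub> h' \<in> carrier H" using h by simp
    have cl: "g'' (h, h') \<in> carrier N" "coboundary H N \<phi> t (h, h') \<in> carrier N"
      "coboundary H N \<phi> s (h, h') \<in> carrier N"
      using factor_sets_closed g'' h coboundary_closed t s by auto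
    have "(coboundary H N \<phi> (\<lambda>x. t x \<otimes>\<^bsub>N\<^esub> s x) (h, h') \<otimes>\<^bsub>N\<^esub> g'' (h, h'),
        coboundary H N \<phi> t (h, h') \<otimes>\<^bsub>N\<^esub> coboundary H N \<phi> s (h, h') \<otimes>\<^bsub>N\<^esub> g'' (h, h')) \<in> E (h \<otimes>\<^bsub>H\<^esub> h')"
      using rel_mult[OF hh' coboundary_mult[OF t(1) s(1) h] rel_refl[OF hh' cl(1)]] .
    moreover have "(coboundary H N \<phi> t (h, h') \<otimes>\<^bsub>N\<^esub> (coboundary H N \<phi> s (h, h') \<otimes>\<^bsub>N\<^esub> g'' (h, h')),
        coboundary H N \<phi> t (h, h') \<otimes>\<^bsub>N\<^esub> g' (h, h')) \<in> E (h \<otimes>\<^bsub>H\<^esub> h')"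
      using rel_lmult[OF hh' cl(2) rels[OF h]] .
    ultimately show "(coboundary H N \<phi> (\<lambda>x. t x \<otimes>\<^bsub>N\<^esub> s x) (h, h') \<otimes>\<^bsub>N\<^esub> g'' (h, h'), g (h, h'))
        \<in> E (h \<otimes>\<^bsub>H\<^esub> h')"
      using relt[OF h] cl by (simp add: N.m_assoc) (blast intro: rel_trans[OF hh'])
  qed (use t s in \<open>auto simp: Pi_iff\<close>)
qed

lemma equiv_cohomologous: "equiv (factor_sets H N E \<phi>) (cohomologous H N E \<phi>)"
proof (rule equivI)
  show "cohomologous H N E \<phi> \<subseteq> factor_sets H N E \<phi> \<times> factor_sets H N E \<phi>"
    by (auto simp: cohomologous_def)
  show "refl_on (factor_sets H N E \<phi>) (cohomologous H N E \<phi>)"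
    by (rule refl_onI) (rule cohomologous_refl)
  show "sym (cohomologous H N E \<phi>)"
    by (rule symI) (rule cohomologous_sym)
  show "trans (cohomologous H N E \<phi>)"
    by (rule transI) (rule cohomologous_trans)
qed

lemma factor_mult_comm:
  assumes "g \<in> factor_sets H N E \<phi>" "g' \<in> factor_sets H N E \<phi>"
  shows "factor_mult H N g g' = factor_mult H N g' g"
  using factor_sets_closed[OF assms(1)] factor_sets_closed[OF assms(2)]
  by (auto simp: factor_mult_def N.m_comm intro!: restrict_ext)

lemma factor_mult_assoc:
  assumes "g \<in> factor_sets H N E \<phi>" "g' \<in> factor_sets H N E \<phi>" "g'' \<in> factor_sets H N E \<phi>"
  shows "factor_mult H N (factor_mult H N g g') g'' = factor_mult H N g (factor_mult H N g' g'')"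
  using assms[THEN factor_sets_closed]
  by (auto simp: factor_mult_def N.m_assoc intro!: restrict_ext)

lemma factor_one_mult:
  assumes "g \<in> factor_sets H N E \<phi>"
  shows "factor_mult H N (factor_one H N) g = g"
  using factor_sets_closed[OF assms] factor_sets_ext[OF assms]
  by (auto simp: factor_mult_def factor_one_def PiE_iff extensional_def fun_eq_iff)

lemma factor_mult_inv:
  assumes "g \<in> factor_sets H N E \<phi>"
  shows "factor_mult H N g (factor_inv H N g) = factor_one H N"
  using factor_sets_closed[OF assms]
  by (auto simp: factor_mult_def factor_one_def factor_inv_def intro!: restrict_ext)

lemma factor_mult_cohomologous:
  assumes "(g\<^sub>1, g\<^sub>1') \<in> cohomologous H N E \<phi>" and g\<^sub>2: "g\<^sub>2 \<in> factor_sets H N E \<phi>"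
  shows "(factor_mult H N g\<^sub>1 g\<^sub>2, factor_mult H N g\<^sub>1' g\<^sub>2) \<in> cohomologous H N E \<phi>"
proof -
  obtain t where g: "g\<^sub>1 \<in> factor_sets H N E \<phi>" "g\<^sub>1' \<in> factor_sets H N E \<phi>"
    and t: "t \<in> carrier H \<rightarrow> carrier N" "t \<one>\<^bsub>H\<^esub> = \<one>\<^bsub>N\<^esub>"
    and rel: "\<And>h h'. h \<in> carrier H \<Longrightarrow> h' \<in> carrier H \<Longrightarrow>
      (coboundary H N \<phi> t (h, h') \<otimes>\<^bsub>N\<^esub> g\<^sub>1' (h, h'), g\<^sub>1 (h, h')) \<in> E (h \<otimes>\<^bsub>H\<^esub> h')"
    using assms(1) by (rule cohomologousE) blast
  show ?thesis
  proof (rule cohomologousI[OF _ _ t])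
    fix h h' assume h: "h \<in> carrier H" "h' \<in> carrier H"
    then have "(coboundary H N \<phi> t (h, h') \<otimes>\<^bsub>N\<^esub> g\<^sub>1' (h, h') \<otimes>\<^bsub>N\<^esub> g\<^sub>2 (h, h'), g\<^sub>1 (h, h') \<otimes>\<^bsub>N\<^esub> g\<^sub>2 (h, h'))
        \<in> E (h \<otimes>\<^bsub>H\<^esub> h')"
      using rel_mult[OF _ rel[OF h] rel_refl] factor_sets_closed[OF g\<^sub>2 h] by simp
    then show "(coboundary H N \<phi> t (h, h') \<otimes>\<^bsub>N\<^esub> factor_mult H N g\<^sub>1' g\<^sub>2 (h, h'),
        factor_mult H N g\<^sub>1 g\<^sub>2 (h, h')) \<in> E (h \<otimes>\<^bsub>H\<^esub> h')"
      using h factor_sets_closed[OF g\<^sub>2 h] factor_sets_closed[OF g(2) h] coboundary_closed[OF t(1) h]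
      by (simp add: factor_mult_def N.m_assoc)
  qed (use g g\<^sub>2 factor_mult_in in auto)
qed

text \<open>
  The union over all representatives that defines the operation collapses to one class. By
  commutativity it is enough to vary one of the two factors.
\<close>

lemma H2_mult_class:
  assumes g: "g \<in> factor_sets H N E \<phi>" and g': "g' \<in> factor_sets H N E \<phi>"
  shows "factor_class H N E \<phi> g \<otimes>\<^bsub>H2 H N E \<phi>\<^esub> factor_class H N E \<phi> g' =
    factor_class H N E \<phi> (factor_mult H N g g')"
proof -
  have "congruent2 (cohomologous H N E \<phi>) (cohomologous H N E \<phi>)
      (\<lambda>g g'. factor_class H N E \<phi> (factor_mult H N g g'))"
  proof (rule congruent2_commuteI[OF equiv_cohomologous])
    show "factor_class H N E \<phi> (factor_mult H N y z) = factor_class H N E \<phi> (factor_mult H N z y)"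
      if "y \<in> factor_sets H N E \<phi>" "z \<in> factor_sets H N E \<phi>" for y z
      using factor_mult_comm[OF that] by simp
    show "factor_class H N E \<phi> (factor_mult H N z y) = factor_class H N E \<phi> (factor_mult H N z y')"
      if "z \<in> factor_sets H N E \<phi>" "(y, y') \<in> cohomologous H N E \<phi>" for y y' z
    proof -
      have "y \<in> factor_sets H N E \<phi>" "y' \<in> factor_sets H N E \<phi>"
        using that(2) by (auto simp: cohomologous_def)
      with factor_mult_cohomologous[OF that(2,1)] show ?thesis
        unfolding factor_class_def
        by (simp add: equiv_class_eq[OF equiv_cohomologous] factor_mult_comm[OF that(1)])
    qed
  qed
  from UN_equiv_class2[OF equiv_cohomologous equiv_cohomologous this g g'] show ?thesis
    by (simp add: H2_def factor_class_def)
qed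

end

text \<open>
  Both the defining conditions of a factor set and the relation \<open>\<equiv>\<close> only become weaker when \<open>E\<close>
  grows, so \<open>\<ell>\<close> is well defined on classes.
\<close>

lemma H2_map_class:
  assumes "compatible_family H N \<phi> E" "compatible_family H N \<phi> E'"
    and le: "\<And>h. h \<in> carrier H \<Longrightarrow> E h \<subseteq> E' h" and g: "g \<in> factor_sets H N E \<phi>"
  shows "g \<in> factor_sets H N E' \<phi>"
    and "H2_map H N \<phi> E' (factor_class H N E \<phi> g) = factor_class H N E' \<phi> g"
proof -
  interpret E: compatible_family H N \<phi> E by fact
  interpret E': compatible_family H N \<phi> E' by fact
  have up: "(a, b) \<in> E' h" if "h \<in> carrier H" "(a, b) \<in> E h" for a b h
    using le that by blast
  have fs: "f \<in> factor_sets H N E' \<phi>" if f: "f \<in> factor_sets H N E \<phi>" for f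
    by (rule E'.factor_setsI)
      (simp_all add: up E.factor_sets_ext[OF f] E.factor_sets_normalized[OF f]
        E.factor_sets_cocycle[OF f])
  show "g \<in> factor_sets H N E' \<phi>"
    by (rule fs[OF g])
  have "(f, f') \<in> cohomologous H N E' \<phi>" if "(f, f') \<in> cohomologous H N E \<phi>" for f f'
  proof -
    obtain t where "f \<in> factor_sets H N E \<phi>" "f' \<in> factor_sets H N E \<phi>"
      and t: "t \<in> carrier H \<rightarrow> carrier N" "t \<one>\<^bsub>H\<^esub> = \<one>\<^bsub>N\<^esub>"
      and rel: "\<And>h h'. h \<in> carrier H \<Longrightarrow> h' \<in> carrier H \<Longrightarrow>
        (coboundary H N \<phi> t (h, h') \<otimes>\<^bsub>N\<^esub> f' (h, h'), f (h, h')) \<in> E (h \<otimes>\<^bsub>H\<^esub> h')"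
      using \<open>(f, f') \<in> cohomologous H N E \<phi>\<close> by (rule E.cohomologousE) blast
    then show ?thesis
      by (intro E'.cohomologousI[OF fs fs t]) (simp_all add: up rel)
  qed
  then have "congruent (cohomologous H N E \<phi>) (factor_class H N E' \<phi>)"
    unfolding factor_class_def
    by (auto intro!: congruentI equiv_class_eq[OF E'.equiv_cohomologous])
  from UN_equiv_class[OF E.equiv_cohomologous this g]
  show "H2_map H N \<phi> E' (factor_class H N E \<phi> g) = factor_class H N E' \<phi> g"
    by (simp add: H2_map_def factor_class_def)
qed


section \<open>Inverses in commutative monoids\<close>

text \<open>
  For inverses \<open>c\<close> and \<open>d\<close> of \<open>a\<close>, commutativity gives \<open>c = c a c = c (a d a) c = (c a c) a d = c a d\<close>,
  and the last expression is symmetric in \<open>c\<close> and \<open>d\<close>.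
\<close>

lemma (in comm_monoid) is_inverse_of_unique:
  assumes a: "a \<in> carrier G" and b: "is_inverse_of G a b" and b': "is_inverse_of G a b'"
  shows "b = b'"
proof -
  have *: "c = c \<otimes> a \<otimes> d" if "is_inverse_of G a c" "is_inverse_of G a d" for c d
  proof -
    have cd: "c \<in> carrier G" "d \<in> carrier G" "a \<otimes> d \<otimes> a = a" "c \<otimes> a \<otimes> c = c"
      using that by (auto simp: is_inverse_of_def)
    have "c = c \<otimes> (a \<otimes> d \<otimes> a) \<otimes> c" using cd by simp
    also have "\<dots> = (c \<otimes> a \<otimes> c) \<otimes> a \<otimes> d"
      using a cd(1,2) by (simp add: m_ac)
    finally show ?thesis using cd by simp
  qed
  have "b \<in> carrier G" "b' \<in> carrier G"
    using b b' by (auto simp: is_inverse_of_def)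
  then have "b \<otimes> a \<otimes> b' = b' \<otimes> a \<otimes> b"
    using a by (simp add: m_ac)
  then show ?thesis
    using *[OF b b'] *[OF b' b] by simp
qed


section \<open>The algebra of all cohomology classes\<close>

locale valid_monoid_action = H: monoid H + N: comm_group N
  for H :: "('h, 'p) monoid_scheme" and N :: "('n, 'q) monoid_scheme" +
  fixes \<phi> :: "'h \<times> 'n \<Rightarrow> 'n"
  assumes valid: "valid_action H N \<phi>"
begin

sublocale Ord: upper_semilattice "compatible_order H N \<phi>"
  by (rule upper_semilattice_compatible) unfold_locales

sublocale Bot: weak_partial_order_bottom "compatible_order H N \<phi>"
  by (rule weak_partial_order_bottom_compatible[OF _ _ valid]) unfold_locales

lemma compatible_family_iff: "compatible_family H N \<phi> E \<longleftrightarrow> compatible H N \<phi> E"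
  using H.monoid_axioms N.comm_group_axioms
  by (simp add: compatible_family_def compatible_family_axioms_def)

abbreviation Join (infixl "\<squnion>" 65) where
  "E\<^sub>1 \<squnion> E\<^sub>2 \<equiv> E\<^sub>1 \<squnion>\<^bsub>compatible_order H N \<phi>\<^esub> E\<^sub>2"

abbreviation Bottom ("\<bottom>") where
  "\<bottom> \<equiv> \<bottom>\<^bsub>compatible_order H N \<phi>\<^esub>"

abbreviation pair_class where
  "pair_class E g \<equiv> (E, factor_class H N E \<phi> g)"

lemma join_compatible: "compatible H N \<phi> E\<^sub>1 \<Longrightarrow> compatible H N \<phi> E\<^sub>2 \<Longrightarrow> compatible H N \<phi> (E\<^sub>1 \<squnion> E\<^sub>2)"
  using Ord.join_closed[of E\<^sub>1 E\<^sub>2] by simp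

lemma bottom_compatible: "compatible H N \<phi> \<bottom>"
  using Bot.bottom_closed by simp

lemma factor_sets_mono:
  assumes "compatible H N \<phi> E" "compatible H N \<phi> E'" "E \<sqsubseteq>\<^bsub>compatible_order H N \<phi>\<^esub> E'"
    and "g \<in> factor_sets H N E \<phi>"
  shows "g \<in> factor_sets H N E' \<phi>"
  using assms H2_map_class(1)[of H N \<phi> E E' g] by (simp add: compatible_family_iff)

lemma factor_sets_join:
  assumes "compatible H N \<phi> E\<^sub>1" "compatible H N \<phi> E\<^sub>2"
  shows "g \<in> factor_sets H N E\<^sub>1 \<phi> \<Longrightarrow> g \<in> factor_sets H N (E\<^sub>1 \<squnion> E\<^sub>2) \<phi>"
    and "g \<in> factor_sets H N E\<^sub>2 \<phi> \<Longrightarrow> g \<in> factor_sets H N (E\<^sub>1 \<squnion> E\<^sub>2) \<phi>"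
  using factor_sets_mono[OF _ join_compatible] Ord.join_left[of E\<^sub>1 E\<^sub>2] Ord.join_right[of E\<^sub>1 E\<^sub>2]
    assms by simp_all

lemma factor_mult_join:
  assumes "compatible H N \<phi> E\<^sub>1" "compatible H N \<phi> E\<^sub>2"
    and "g\<^sub>1 \<in> factor_sets H N E\<^sub>1 \<phi>" "g\<^sub>2 \<in> factor_sets H N E\<^sub>2 \<phi>"
  shows "factor_mult H N g\<^sub>1 g\<^sub>2 \<in> factor_sets H N (E\<^sub>1 \<squnion> E\<^sub>2) \<phi>"
  using compatible_family.factor_mult_in[of H N \<phi> "E\<^sub>1 \<squnion> E\<^sub>2"] factor_sets_join join_compatible assms
  by (simp add: compatible_family_iff)

lemma tilde_carrierI:
  "compatible H N \<phi> E \<Longrightarrow> g \<in> factor_sets H N E \<phi> \<Longrightarrow> pair_class E g \<in> carrier (H2_tilde H N \<phi>)"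
  by (auto simp: H2_tilde_def H2_def factor_class_def intro: quotientI)

lemma tilde_carrierE:
  assumes "a \<in> carrier (H2_tilde H N \<phi>)"
  obtains E g where "compatible H N \<phi> E" "g \<in> factor_sets H N E \<phi>" "a = pair_class E g"
  using assms by (auto simp: H2_tilde_def H2_def factor_class_def elim!: quotientE)

text \<open>
  The formula to which all laws of the algebra are reduced.
\<close>

lemma tilde_mult:
  assumes c: "compatible H N \<phi> E\<^sub>1" "compatible H N \<phi> E\<^sub>2"
    and g: "g\<^sub>1 \<in> factor_sets H N E\<^sub>1 \<phi>" "g\<^sub>2 \<in> factor_sets H N E\<^sub>2 \<phi>"
  shows "pair_class E\<^sub>1 g\<^sub>1 \<otimes>\<^bsub>H2_tilde H N \<phi>\<^esub> pair_class E\<^sub>2 g\<^sub>2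
    = pair_class (E\<^sub>1 \<squnion> E\<^sub>2) (factor_mult H N g\<^sub>1 g\<^sub>2)"
proof -
  interpret J: compatible_family H N \<phi> "E\<^sub>1 \<squnion> E\<^sub>2"
    using c by (simp add: compatible_family_iff join_compatible)
  have "H2_map H N \<phi> (E\<^sub>1 \<squnion> E\<^sub>2) (factor_class H N E\<^sub>1 \<phi> g\<^sub>1) = factor_class H N (E\<^sub>1 \<squnion> E\<^sub>2) \<phi> g\<^sub>1"
    using Ord.join_left[of E\<^sub>1 E\<^sub>2] c g J.compatible_family_axioms
    by (intro H2_map_class(2)) (auto simp: compatible_family_iff)
  moreover have "H2_map H N \<phi> (E\<^sub>1 \<squnion> E\<^sub>2) (factor_class H N E\<^sub>2 \<phi> g\<^sub>2) = factor_class H N (E\<^sub>1 \<squnion> E\<^sub>2) \<phi> g\<^sub>2"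
    using Ord.join_right[of E\<^sub>1 E\<^sub>2] c g J.compatible_family_axioms
    by (intro H2_map_class(2)) (auto simp: compatible_family_iff)
  ultimately show ?thesis
    using J.H2_mult_class factor_sets_join[OF c] g by (simp add: H2_tilde_def Let_def)
qed

lemma tilde_one: "\<one>\<^bsub>H2_tilde H N \<phi>\<^esub> = pair_class \<bottom> (factor_one H N)"
  by (simp add: H2_tilde_def H2_def)

lemma bottom_join: "compatible H N \<phi> E \<Longrightarrow> \<bottom> \<squnion> E = E"
  using Ord.le_antisym[of "\<bottom> \<squnion> E" E] Ord.join_le[of "\<bottom>" E E] Ord.join_right[of "\<bottom>" E]
    Ord.le_refl[of E] Bot.bottom_lower[of E] join_compatible bottom_compatible
  by simp

lemma join_idem: "compatible H N \<phi> E \<Longrightarrow> E \<squnion> E = E"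
  using Ord.le_antisym[of "E \<squnion> E" E] Ord.join_le[of E E E] Ord.join_right[of E E]
    Ord.le_refl[of E] join_compatible
  by simp

text \<open>
  Each law of factor sets is applied inside the group over the join of all families involved, to which
  the representatives of the smaller groups belong as well.
\<close>

lemma comm_monoid_tilde: "comm_monoid (H2_tilde H N \<phi>)"
proof (rule comm_monoidI)
  fix a b assume "a \<in> carrier (H2_tilde H N \<phi>)" "b \<in> carrier (H2_tilde H N \<phi>)"
  then obtain E\<^sub>1 g\<^sub>1 E\<^sub>2 g\<^sub>2 where c: "compatible H N \<phi> E\<^sub>1" "compatible H N \<phi> E\<^sub>2"
    and g: "g\<^sub>1 \<in> factor_sets H N E\<^sub>1 \<phi>" "g\<^sub>2 \<in> factor_sets H N E\<^sub>2 \<phi>"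
    and [simp]: "a = pair_class E\<^sub>1 g\<^sub>1" "b = pair_class E\<^sub>2 g\<^sub>2"
    by (metis tilde_carrierE)
  show "a \<otimes>\<^bsub>H2_tilde H N \<phi>\<^esub> b \<in> carrier (H2_tilde H N \<phi>)"
    using tilde_mult[OF c g] tilde_carrierI[OF join_compatible[OF c] factor_mult_join[OF c g]] by simp
  have "factor_mult H N g\<^sub>1 g\<^sub>2 = factor_mult H N g\<^sub>2 g\<^sub>1"
    using compatible_family.factor_mult_comm[of H N \<phi> "E\<^sub>1 \<squnion> E\<^sub>2" g\<^sub>1 g\<^sub>2] c g
    by (simp add: compatible_family_iff join_compatible factor_sets_join)
  then show "a \<otimes>\<^bsub>H2_tilde H N \<phi>\<^esub> b = b \<otimes>\<^bsub>H2_tilde H N \<phi>\<^esub> a"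
    using tilde_mult[OF c g] tilde_mult[OF c(2,1) g(2,1)]
      join_comm[of "compatible_order H N \<phi>" E\<^sub>1 E\<^sub>2] by simp
next
  fix a b d assume "a \<in> carrier (H2_tilde H N \<phi>)" "b \<in> carrier (H2_tilde H N \<phi>)"
    "d \<in> carrier (H2_tilde H N \<phi>)"
  then obtain E\<^sub>1 g\<^sub>1 E\<^sub>2 g\<^sub>2 E\<^sub>3 g\<^sub>3
    where c: "compatible H N \<phi> E\<^sub>1" "compatible H N \<phi> E\<^sub>2" "compatible H N \<phi> E\<^sub>3"
      and g: "g\<^sub>1 \<in> factor_sets H N E\<^sub>1 \<phi>" "g\<^sub>2 \<in> factor_sets H N E\<^sub>2 \<phi>" "g\<^sub>3 \<in> factor_sets H N E\<^sub>3 \<phi>"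
      and [simp]: "a = pair_class E\<^sub>1 g\<^sub>1" "b = pair_class E\<^sub>2 g\<^sub>2" "d = pair_class E\<^sub>3 g\<^sub>3"
    by (metis tilde_carrierE)
  have assoc: "E\<^sub>1 \<squnion> E\<^sub>2 \<squnion> E\<^sub>3 = E\<^sub>1 \<squnion> (E\<^sub>2 \<squnion> E\<^sub>3)"
    using Ord.join_assoc c by simp
  have "g\<^sub>1 \<in> factor_sets H N (E\<^sub>1 \<squnion> E\<^sub>2 \<squnion> E\<^sub>3) \<phi>" "g\<^sub>2 \<in> factor_sets H N (E\<^sub>1 \<squnion> E\<^sub>2 \<squnion> E\<^sub>3) \<phi>"
    "g\<^sub>3 \<in> factor_sets H N (E\<^sub>1 \<squnion> E\<^sub>2 \<squnion> E\<^sub>3) \<phi>"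
    using c g by (simp_all add: join_compatible factor_sets_join)
  then have "factor_mult H N (factor_mult H N g\<^sub>1 g\<^sub>2) g\<^sub>3 = factor_mult H N g\<^sub>1 (factor_mult H N g\<^sub>2 g\<^sub>3)"
    using compatible_family.factor_mult_assoc[of H N \<phi> "E\<^sub>1 \<squnion> E\<^sub>2 \<squnion> E\<^sub>3"] c
    by (simp add: compatible_family_iff join_compatible)
  then show "a \<otimes>\<^bsub>H2_tilde H N \<phi>\<^esub> b \<otimes>\<^bsub>H2_tilde H N \<phi>\<^esub> d = a \<otimes>\<^bsub>H2_tilde H N \<phi>\<^esub> (b \<otimes>\<^bsub>H2_tilde H N \<phi>\<^esub> d)"
    using c g by (simp add: tilde_mult join_compatible factor_mult_join assoc)
next
  have one: "factor_one H N \<in> factor_sets H N \<bottom> \<phi>"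
    using compatible_family.factor_one_in[of H N \<phi> "\<bottom>"] bottom_compatible
    by (simp add: compatible_family_iff)
  then show "\<one>\<^bsub>H2_tilde H N \<phi>\<^esub> \<in> carrier (H2_tilde H N \<phi>)"
    using tilde_carrierI bottom_compatible by (simp add: tilde_one)
  fix a assume "a \<in> carrier (H2_tilde H N \<phi>)"
  then obtain E g where c: "compatible H N \<phi> E" and g: "g \<in> factor_sets H N E \<phi>"
    and [simp]: "a = pair_class E g"
    by (rule tilde_carrierE)
  show "\<one>\<^bsub>H2_tilde H N \<phi>\<^esub> \<otimes>\<^bsub>H2_tilde H N \<phi>\<^esub> a = a"
    using tilde_mult[OF bottom_compatible c one g] c g
      compatible_family.factor_one_mult[of H N \<phi> E g]
    by (simp add: tilde_one bottom_join compatible_family_iff)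
qed

lemma is_inverse_of_tilde:
  assumes c: "compatible H N \<phi> E" and g: "g \<in> factor_sets H N E \<phi>"
  shows "is_inverse_of (H2_tilde H N \<phi>) (pair_class E g) (pair_class E (factor_inv H N g))"
proof -
  interpret E: compatible_family H N \<phi> E using c by (simp add: compatible_family_iff)
  have i: "factor_inv H N g \<in> factor_sets H N E \<phi>" by (rule E.factor_inv_in[OF g])
  have "factor_mult H N (factor_inv H N g) g = factor_one H N"
    using E.factor_mult_comm[OF i g] E.factor_mult_inv[OF g] by simp
  then show ?thesis
    unfolding is_inverse_of_def using c g i
    by (simp add: tilde_mult tilde_carrierI join_idem E.factor_mult_in E.factor_mult_inv
        E.factor_one_in E.factor_one_mult)
qed

end

theorem theorem3p9:
  fixes H :: "('h, 'p) monoid_scheme" and N :: "('n, 'q) monoid_scheme"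
    and \<phi> :: "'h \<times> 'n \<Rightarrow> 'n"
  assumes "monoid H" and "comm_group N" and "valid_action H N \<phi>"
  shows "inverse_monoid (H2_tilde H N \<phi>) \<and>
    (\<forall>E g. compatible H N \<phi> E \<longrightarrow> g \<in> factor_sets H N E \<phi> \<longrightarrow>
       is_inverse_of (H2_tilde H N \<phi>)
         (E, factor_class H N E \<phi> g) (E, factor_class H N E \<phi> (factor_inv H N g)))"
proof -
  interpret valid_monoid_action H N \<phi>
    using assms by (simp add: valid_monoid_action_def valid_monoid_action_axioms_def)
  interpret T: comm_monoid "H2_tilde H N \<phi>" by (rule comm_monoid_tilde)
  have "\<exists>!b. is_inverse_of (H2_tilde H N \<phi>) a b" if "a \<in> carrier (H2_tilde H N \<phi>)" for a
    using that is_inverse_of_tilde T.is_inverse_of_unique[OF that] by (metis tilde_carrierE)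
  then show ?thesis
    using is_inverse_of_tilde T.monoid_axioms by (auto simp: inverse_monoid_def)
qed

end
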